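(* Let $H$ be a graph and $n\geq 2$ an integer. Then: (1) If $H$ is vertex-transitive and $F$ is an $H$-forest, then $\chi_F(\mathbb{R}^n)=\chi_H(\mathbb{R}^n)$ and $\chi^{\mathrm{ind}}_F(\mathbb{R}^n)=\chi^{\mathrm{ind}}_H(\mathbb{R}^n)$. (2) If $H$ has zero hypercube Turán density, then $\chi_H(\mathbb{R}^n)=\chi(\mathbb{R}^n)$; if $H$ has zero induced hypercube Turán density, then $\chi^{\mathrm{ind}}_H(\mathbb{R}^n)=\chi(\mathbb{R}^n)$. (3) Let $u,v$ be two vertices of $H$, let $\Gamma$ be a bipartite graph with parts $A$ and $B$ which has zero strong hypercube Turán density with respect to $(A,B)$, and let $F=\Gamma_{A,B}(H,u,v)$. Then $\chi_F(\mathbb{R}^n)=\chi_H(\mathbb{R}^n)$.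
   Context: Graphs are finite and non-empty. A unit-copy of $H=(V,E)$ in $\mathbb{R}^n$ is a set $A\subseteq\mathbb{R}^n$, $|A|=|V|$, with a bijection $f:V\to A$ such that $uv\in E$ implies $\|f(u)-f(v)\|=1$; it is induced if also $uv\notin E$ implies $\|f(u)-f(v)\|\neq1$. $\chi_H(\mathbb{R}^n)$ (resp. $\chi^{\mathrm{ind}}_H(\mathbb{R}^n)$) is the least $r$ such that some $r$-coloring of $\mathbb{R}^n$ has no monochromatic unit-copy (resp. induced unit-copy) of $H$; $\chi(\mathbb{R}^n)$ is the chromatic number of $\mathbb{R}^n$ (least number of colors with no two same-colored points at distance $1$). An $H$-forest is a union of pairwise edge-disjoint copies $H_1,\dots,H_m$ of $H$ with each $V(H_i)$ meeting $\bigcup_{j<i}V(H_j)$ in at most one vertex. The hypercube $Q_N$ has vertex set $\{0,1\}^N$, adjacency = differing in exactly one coordinate; its $k$-th vertex layer consists of vertices with exactly $k$ ones. $H$ has zero (induced) hypercube Turán density if the maximum fraction of edges of $Q_N$ in a subgraph of $Q_N$ with no (induced) copy of $H$ tends to $0$ as $N\to\infty$. For a bipartite $\Gamma$ with parts $A,B$, $m(N,\Gamma,A,B)$ is the maximum number of edges of a subgraph of $Q_N$ with no copy of $\Gamma$ having its $A$-vertices in the $k$-th vertex layer and its $B$-vertices in the $(k-1)$-th vertex layer for some $k\le N$; zero strong hypercube Turán density w.r.t. $(A,B)$ means $m(N,\Gamma,A,B)=o(|E(Q_N)|)$. $\Gamma_{A,B}(H,u,v)$ is obtained from $\Gamma$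 by replacing each edge $ab$ ($a\in A,b\in B$) with a copy of $H$ in which $(a,b)$ plays the role of $(u,v)$. *)

theory Defs
  imports "HOL-Analysis.Analysis" "HOL-Library.Landau_Symbols" "HOL-Library.Extended_Nat"
begin

type_synonym 'v graph = "'v set \<times> 'v set set"

abbreviation verts :: "'v graph \<Rightarrow> 'v set" where "verts \<equiv> fst"
abbreviation edges :: "'v graph \<Rightarrow> 'v set set" where "edges \<equiv> snd"

definition simple_graph :: "'v graph \<Rightarrow> bool" where
  "simple_graph G \<longleftrightarrow> finite (verts G) \<and> verts G \<noteq> {} \<and>
     edges G \<subseteq> {{x, y} | x y. x \<in> verts G \<and> y \<in> verts G \<and> x \<noteq> y}"

definition subgraph :: "'v graph \<Rightarrow> 'v graph \<Rightarrow> bool" where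
  "subgraph K G \<longleftrightarrow> verts K \<subseteq> verts G \<and> edges K \<subseteq> edges G \<and> edges K \<subseteq> Pow (verts K)"

definition induced_subgraph :: "'v graph \<Rightarrow> 'v graph \<Rightarrow> bool" where
  "induced_subgraph K G \<longleftrightarrow> verts K \<subseteq> verts G \<and> edges K = {e \<in> edges G. e \<subseteq> verts K}"

definition graph_iso :: "('v \<Rightarrow> 'w) \<Rightarrow> 'v graph \<Rightarrow> 'w graph \<Rightarrow> bool" where
  "graph_iso f G K \<longleftrightarrow> bij_betw f (verts G) (verts K) \<and> edges K = (\<lambda>e. f ` e) ` edges G"

definition copy_of :: "'w graph \<Rightarrow> 'v graph \<Rightarrow> bool" where
  "copy_of K H \<longleftrightarrow> (\<exists>f. graph_iso f H K)"

definition contains_copy :: "'w graph \<Rightarrow> 'v graph \<Rightarrow> bool" where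
  "contains_copy G H \<longleftrightarrow> (\<exists>K. subgraph K G \<and> copy_of K H)"

definition contains_induced_copy :: "'w graph \<Rightarrow> 'v graph \<Rightarrow> bool" where
  "contains_induced_copy G H \<longleftrightarrow> (\<exists>K. induced_subgraph K G \<and> copy_of K H)"

definition vertex_transitive :: "'v graph \<Rightarrow> bool" where
  "vertex_transitive H \<longleftrightarrow>
     (\<forall>x \<in> verts H. \<forall>y \<in> verts H. \<exists>f. graph_iso f H H \<and> f x = y)"

definition is_forest_of :: "'w graph \<Rightarrow> 'v graph \<Rightarrow> bool" where
  "is_forest_of F H \<longleftrightarrow> (\<exists>Hs :: 'w graph list.
     Hs \<noteq> [] \<and>
     (\<forall>i < length Hs. copy_of (Hs ! i) H) \<and>
     (\<forall>i < length Hs. \<forall>j < i. edges (Hs ! i) \<inter> edges (Hs ! j) = {}) \<and>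
     (\<forall>i < length Hs. card (verts (Hs ! i) \<inter> (\<Union>j<i. verts (Hs ! j))) \<le> 1) \<and>
     F = (\<Union>i<length Hs. verts (Hs ! i), \<Union>i<length Hs. edges (Hs ! i)))"

definition bipartite_with_parts :: "'v graph \<Rightarrow> 'v set \<Rightarrow> 'v set \<Rightarrow> bool" where
  "bipartite_with_parts G A B \<longleftrightarrow> A \<union> B = verts G \<and> A \<inter> B = {} \<and>
     (\<forall>e \<in> edges G. \<exists>a \<in> A. \<exists>b \<in> B. e = {a, b})"

definition unit_copy :: "'v graph \<Rightarrow> 'a::real_normed_vector set \<Rightarrow> bool" where
  "unit_copy H A \<longleftrightarrow> (\<exists>f. bij_betw f (verts H) A \<and>
     (\<forall>x \<in> verts H. \<forall>y \<in> verts H. {x, y} \<in> edges H \<longrightarrow> norm (f x - f y) = 1))"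

definition induced_unit_copy :: "'v graph \<Rightarrow> 'a::real_normed_vector set \<Rightarrow> bool" where
  "induced_unit_copy H A \<longleftrightarrow> (\<exists>f. bij_betw f (verts H) A \<and>
     (\<forall>x \<in> verts H. \<forall>y \<in> verts H. {x, y} \<in> edges H \<longrightarrow> norm (f x - f y) = 1) \<and>
     (\<forall>x \<in> verts H. \<forall>y \<in> verts H. {x, y} \<notin> edges H \<longrightarrow> norm (f x - f y) \<noteq> 1))"

definition monochromatic :: "('a \<Rightarrow> nat) \<Rightarrow> 'a set \<Rightarrow> bool" where
  "monochromatic c A \<longleftrightarrow> (\<exists>i. \<forall>x \<in> A. c x = i)"

text \<open>In the following three definitions, the value is \<open>\<infinity>\<close> (the infimum of the empty
  set) if no finite number of colours suffices.\<close>

definition chi_copy :: "'v graph \<Rightarrow> 'a::real_normed_vector set \<Rightarrow> enat" where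
  "chi_copy H X = (INF r \<in> {r. \<exists>c. c \<in> X \<rightarrow> {..<r} \<and>
     \<not> (\<exists>A \<subseteq> X. unit_copy H A \<and> monochromatic c A)}. enat r)"

definition chi_ind_copy :: "'v graph \<Rightarrow> 'a::real_normed_vector set \<Rightarrow> enat" where
  "chi_ind_copy H X = (INF r \<in> {r. \<exists>c. c \<in> X \<rightarrow> {..<r} \<and>
     \<not> (\<exists>A \<subseteq> X. induced_unit_copy H A \<and> monochromatic c A)}. enat r)"

definition chi :: "'a::real_normed_vector set \<Rightarrow> enat" where
  "chi X = (INF r \<in> {r. \<exists>c. c \<in> X \<rightarrow> {..<r} \<and>
     (\<forall>x \<in> X. \<forall>y \<in> X. norm (x - y) = 1 \<longrightarrow> c x \<noteq> c y)}. enat r)"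

definition cube_verts :: "nat \<Rightarrow> (nat \<Rightarrow> nat) set" where
  "cube_verts N = {..<N} \<rightarrow>\<^sub>E {0, 1}"

definition hypercube :: "nat \<Rightarrow> (nat \<Rightarrow> nat) graph" where
  "hypercube N = (cube_verts N,
     {{x, y} | x y. x \<in> cube_verts N \<and> y \<in> cube_verts N \<and> card {i. i < N \<and> x i \<noteq> y i} = 1})"

definition layer :: "nat \<Rightarrow> nat \<Rightarrow> (nat \<Rightarrow> nat) set" where
  "layer N k = {x \<in> cube_verts N. card {i. i < N \<and> x i = 1} = k}"

definition cube_ex :: "nat \<Rightarrow> 'v graph \<Rightarrow> nat" where
  "cube_ex N H = Max {card (edges G) | G. subgraph G (hypercube N) \<and> \<not> contains_copy G H}"

definition cube_ex_ind :: "nat \<Rightarrow> 'v graph \<Rightarrow> nat" where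
  "cube_ex_ind N H =
     Max {card (edges G) | G. subgraph G (hypercube N) \<and> \<not> contains_induced_copy G H}"

definition zero_cube_density :: "'v graph \<Rightarrow> bool" where
  "zero_cube_density H \<longleftrightarrow>
     (\<lambda>N. real (cube_ex N H) / real (card (edges (hypercube N)))) \<longlonglongrightarrow> 0"

definition zero_induced_cube_density :: "'v graph \<Rightarrow> bool" where
  "zero_induced_cube_density H \<longleftrightarrow>
     (\<lambda>N. real (cube_ex_ind N H) / real (card (edges (hypercube N)))) \<longlonglongrightarrow> 0"

definition contains_layered_copy ::
  "nat \<Rightarrow> (nat \<Rightarrow> nat) graph \<Rightarrow> 'v graph \<Rightarrow> 'v set \<Rightarrow> 'v set \<Rightarrow> bool" where
  "contains_layered_copy N G \<Gamma> A B \<longleftrightarrow> (\<exists>K f k. subgraph K G \<and> graph_iso f \<Gamma> K \<and>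
     1 \<le> k \<and> k \<le> N \<and> f ` A \<subseteq> layer N k \<and> f ` B \<subseteq> layer N (k - 1))"

definition cube_ex_strong :: "nat \<Rightarrow> 'v graph \<Rightarrow> 'v set \<Rightarrow> 'v set \<Rightarrow> nat" where
  "cube_ex_strong N \<Gamma> A B =
     Max {card (edges G) | G. subgraph G (hypercube N) \<and> \<not> contains_layered_copy N G \<Gamma> A B}"

definition zero_strong_cube_density :: "'v graph \<Rightarrow> 'v set \<Rightarrow> 'v set \<Rightarrow> bool" where
  "zero_strong_cube_density \<Gamma> A B \<longleftrightarrow>
     (\<lambda>N. real (cube_ex_strong N \<Gamma> A B)) \<in> o(\<lambda>N. real (card (edges (hypercube N))))"

text \<open>The vertices of \<open>\<Gamma>\<close> are tagged \<open>Inl\<close>. The copy of \<open>H\<close> replacing the edge \<open>ab\<close> is the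
  image of \<open>H\<close> under \<open>role u v a b\<close>; each vertex \<open>w\<close> of it other than \<open>u, v\<close> becomes
  the new vertex \<open>Inr ((a, b), w)\<close>, private to that copy.\<close>

definition role :: "'v \<Rightarrow> 'v \<Rightarrow> 'g \<Rightarrow> 'g \<Rightarrow> 'v \<Rightarrow> 'g + ('g \<times> 'g) \<times> 'v" where
  "role u v a b w = (if w = u then Inl a else if w = v then Inl b else Inr ((a, b), w))"

definition edge_replacement ::
  "'g graph \<Rightarrow> 'g set \<Rightarrow> 'g set \<Rightarrow> 'v graph \<Rightarrow> 'v \<Rightarrow> 'v \<Rightarrow> ('g + ('g \<times> 'g) \<times> 'v) graph" where
  "edge_replacement \<Gamma> A B H u v =
     (let P = {(a, b). a \<in> A \<and> b \<in> B \<and> {a, b} \<in> edges \<Gamma>} in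
       (Inl ` verts \<Gamma> \<union> (\<Union>(a, b) \<in> P. role u v a b ` verts H),
        \<Union>(a, b) \<in> P. (\<lambda>e. role u v a b ` e) ` edges H))"

end

theory Submission imports Defs begin

text \<open>
  If every \<open>r\<close>-colouring of the space contains a monochromatic copy of \<open>H\<close>, then by compactness so does
  every \<open>r\<close>-colouring of some finite set \<open>X\<close>. For generic orthogonal maps \<open>\<rho>\<^sub>1, \<dots>, \<rho>\<^sub>N\<close> the map
  \<open>x \<mapsto> \<rho>\<^sub>1 x\<^sub>1 + \<dots> + \<rho>\<^sub>N x\<^sub>N\<close> embeds the grid \<open>X\<^sup>N\<close> into the space so that every axis-parallel line is
  an isometric copy of \<open>X\<close> and two points on no common line are never at distance 1. Hence in any
  \<open>r\<close>-colouring every line of the grid contains a monochromatic copy of \<open>H\<close>.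

  For hypercube densities (with \<open>H\<close> a single edge in the case of the chromatic number), a random
  subcube of the grid has a positive proportion, independent of \<open>N\<close>, of edges whose end points play
  prescribed roles in such a copy of one fixed colour, so the density assumption applies. For forests,
  the copies of one colour form a hypergraph whose average degree grows with \<open>N\<close>; it contains a
  subhypergraph of large minimum degree, into which a forest is embedded greedily.
\<close>

section \<open>Compactness and generic maps of grids\<close>

text \<open>The order of the choices carries the argument: compactness fixes \<open>X\<close>, and
  with it every constant built from \<open>card X\<close> and \<open>r\<close>, before
  \<open>N\<close> is chosen. The losses in all counts are therefore bounded while \<open>N\<close>
  grows. Dimension at least 2 enters through the generic maps: on a line the only orthogonal maps
  are plus and minus the identity, and such a sum already fails to be injective on
  \<open>X \<times> X\<close> when \<open>X\<close> has two points. Three features of the hypotheses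
  answer three obstacles. A copy found through a given grid point puts an uncontrolled vertex of
  \<open>H\<close> there; vertex-transitivity permits relabelling it. A cube edge has two ends that
  must be told apart as places of \<open>u\<close> and \<open>v\<close>; the layers of the strong
  density orient it. An induced copy also has to exclude unit distances between points of different
  lines; this is the second half of genericity. The opposite inequalities come from containment: a
  forest or an edge replacement contains \<open>H\<close>, and \<open>H\<close> contains an
  edge.\<close>

lemma colouring_compactness:
  fixes \<A> :: "'a set set"
  assumes "0 < r" and fin: "\<And>A. A \<in> \<A> \<Longrightarrow> finite A"
    and mono: "\<And>c. c \<in> UNIV \<rightarrow> {..<r} \<Longrightarrow> \<exists>A\<in>\<A>. monochromatic c A"
  obtains X where "finite X"
    "\<And>c. c \<in> X \<rightarrow> {..<r} \<Longrightarrow> \<exists>A\<in>\<A>. A \<subseteq> X \<and> monochromatic c A"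
proof -
  define T where "T = product_topology (\<lambda>_::'a. discrete_topology {..<r}) UNIV"
  \<comment> \<open>\<open>U A\<close> collects the colourings constant on \<open>A\<close>. Since
    \<open>A\<close> is finite it is a union of basic open sets of the product, and
    \<open>mono\<close> says that these sets cover the product, which is compact by
    Tychonoff.\<close>
  define U where "U A = (\<Union>i<r. Pi\<^sub>E UNIV (\<lambda>x. if x \<in> A then {i} else {..<r}))" for A :: "'a set"
  have top: "topspace T = UNIV \<rightarrow>\<^sub>E {..<r}" by (simp add: T_def)
  have comp: "compact_space T"
    by (simp add: T_def compact_space_product_topology compact_space_discrete_topology)
  have "openin T (U A)" if "A \<in> \<A>" for A
    unfolding U_def T_def
  proof (intro openin_Union ballI, elim imageE)
    fix S i assume i: "i \<in> {..<r}" and S: "S = Pi\<^sub>E UNIV (\<lambda>x. if x \<in> A then {i} else {..<r})"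
    have "{x. (if x \<in> A then {i} else {..<r}) \<noteq> {..<r}} \<subseteq> A" by auto
    then have "finite {x. (if x \<in> A then {i} else {..<r}) \<noteq> {..<r}}"
      using fin[OF that] finite_subset by blast
    then show "openin (product_topology (\<lambda>_. discrete_topology {..<r}) UNIV) S"
      unfolding S using i by (subst openin_PiE_gen) (auto split: if_splits)
  qed
  then have op: "Ball (U ` \<A>) (openin T)" by blast
  have cov: "topspace T \<subseteq> \<Union>(U ` \<A>)"
  proof
    fix c assume "c \<in> topspace T"
    then have c: "c \<in> UNIV \<rightarrow> {..<r}" by (auto simp: top)
    then obtain A i where A: "A \<in> \<A>" "\<forall>x\<in>A. c x = i"
      using mono unfolding monochromatic_def by blast
    \<comment> \<open>The colour witnessing that an empty set is monochromatic may lie outside the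
      palette, so it is replaced by one below \<open>r\<close>.\<close>
    have "\<exists>k<r. \<forall>x\<in>A. c x = k"
      using A c \<open>0 < r\<close> by (cases "A = {}") (auto simp: Pi_iff)
    then obtain k where "k < r" "\<forall>x\<in>A. c x = k" by blast
    then have "c \<in> U A"
      unfolding U_def using c by (intro UN_I[of k]) (auto simp: PiE_iff)
    then show "c \<in> \<Union>(U ` \<A>)" using A by blast
  qed
  obtain \<F> where \<F>: "finite \<F>" "\<F> \<subseteq> U ` \<A>" "topspace T \<subseteq> \<Union>\<F>"
    using comp op cov unfolding compact_space_alt by (metis (no_types))
  then obtain \<B> where \<B>: "finite \<B>" "\<B> \<subseteq> \<A>" "\<F> = U ` \<B>"
    by (meson finite_subset_image)
  show thesis
  proof (rule that[of "\<Union>\<B>"])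
    show "finite (\<Union>\<B>)" using \<B> fin by blast
    fix c assume c: "c \<in> \<Union>\<B> \<rightarrow> {..<r}"
    \<comment> \<open>Points outside the finite set get the dummy colour 0, a legal colour because
      of \<open>0 < r\<close>.\<close>
    define c' where "c' x = (if x \<in> \<Union>\<B> then c x else 0)" for x
    have "c' \<in> topspace T" using c \<open>0 < r\<close> by (auto simp: top c'_def PiE_iff)
    then obtain A where A: "A \<in> \<B>" "c' \<in> U A" using \<F> \<B> by blast
    then obtain i where "c' \<in> Pi\<^sub>E UNIV (\<lambda>x. if x \<in> A then {i} else {..<r})"
      unfolding U_def by blast
    then have "\<forall>x\<in>A. c' x = i" by (auto simp: PiE_iff split: if_splits)
    then have "monochromatic c A" unfolding monochromatic_def c'_def using A(1) by (metis UnionI)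
    then show "\<exists>A\<in>\<A>. A \<subseteq> \<Union>\<B> \<and> monochromatic c A" using A \<B> by blast
  qed
qed

section \<open>Orthogonal maps satisfying finitely many generic conditions\<close>

lemma finite_quadratic_roots:
  fixes c0 c1 c2 :: real
  assumes "c0 \<noteq> 0 \<or> c2 \<noteq> 0"
  shows "finite {t. c0 + t * c1 + t\<^sup>2 * c2 = 0}"
proof -
  have "finite {t. poly [:c0, c1, c2:] t = 0}"
    using assms by (intro poly_roots_finite) auto
  then show ?thesis by (simp add: algebra_simps power2_eq_square)
qed

text \<open>Reflections are a family of orthogonal maps with a vector as parameter: multiplied by
  \<open>a \<bullet> a\<close>, a condition on \<open>\<delta> \<bullet> reflection a d\<close>
  becomes a quadratic form in \<open>a\<close>. Division by zero makes \<open>reflection 0\<close>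
  the identity, which is still orthogonal.\<close>

definition reflection :: "'a::euclidean_space \<Rightarrow> 'a \<Rightarrow> 'a" where
  "reflection a x = x - (2 * (a \<bullet> x) / (a \<bullet> a)) *\<^sub>R a"

lemma orthogonal_transformation_reflection: "orthogonal_transformation (reflection a)"
proof -
  have "linear (reflection a)"
    by (rule linearI) (simp_all add: reflection_def algebra_simps inner_simps add_divide_distrib scaleR_add_left)
  moreover have "reflection a v \<bullet> reflection a w = v \<bullet> w" for v w
    by (cases "a = 0") (simp_all add: reflection_def inner_simps field_simps inner_commute)
  ultimately show ?thesis by (simp add: orthogonal_transformation_def)
qed

text \<open>No single quadratic form in the list vanishes identically. Conditions are added one at a
  time by moving along a line \<open>a + t *\<^sub>R b\<close>: each form restricts to a polynomial
  of degree at most 2 in \<open>t\<close> that is not zero, so only finitely many \<open>t\<close>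
  are excluded.\<close>

lemma exists_generic_reflection_vector:
  fixes T :: "('a::euclidean_space \<times> 'a \<times> real) set"
  assumes dim: "2 \<le> DIM('a)" and "finite T"
    and "\<forall>(\<delta>, d, s)\<in>T. \<delta> \<noteq> 0 \<and> d \<noteq> 0"
  shows "\<exists>a. \<forall>(\<delta>, d, s)\<in>T. (\<delta> \<bullet> d - s) * (a \<bullet> a) - 2 * (a \<bullet> d) * (a \<bullet> \<delta>) \<noteq> 0"
  using assms(2,3)
proof (induction T)
  case empty
  then show ?case by simp
next
  case (insert \<tau> T)
  define q :: "'a \<times> 'a \<times> real \<Rightarrow> 'a \<Rightarrow> real" where
    "q = (\<lambda>(\<delta>, d, s) a. (\<delta> \<bullet> d - s) * (a \<bullet> a) - 2 * (a \<bullet> d) * (a \<bullet> \<delta>))"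
  obtain a where a: "\<forall>\<tau>\<in>T. q \<tau> a \<noteq> 0"
    using insert by (force simp: q_def split: prod.splits)
  obtain \<delta> d s where \<tau>: "\<tau> = (\<delta>, d, s)" by (cases \<tau>)
  then have nz: "\<delta> \<noteq> 0" "d \<noteq> 0" using insert.prems by auto
  \<comment> \<open>A nonzero vector orthogonal to \<open>d\<close>, which exists because the
    dimension is at least 2, isolates the first term of the form. If that term vanishes identically,
    \<open>d\<close> works unless \<open>d\<close> and \<open>\<delta>\<close> are orthogonal, and
    then \<open>d + \<delta>\<close> gives the product of their squared norms up to the factor
    -2.\<close>
  have "\<exists>b. q \<tau> b \<noteq> 0"
  proof (cases "\<delta> \<bullet> d = s")
    case False
    obtain b where "b \<noteq> 0" "orthogonal d b" using orthogonal_to_vector_exists[OF dim] by blast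
    then have "q \<tau> b \<noteq> 0" using False by (simp add: q_def \<tau> orthogonal_def inner_commute)
    then show ?thesis ..
  next
    case True
    show ?thesis
    proof (cases "d \<bullet> \<delta> = 0")
      case False
      then have "q \<tau> d \<noteq> 0" using True nz by (simp add: q_def \<tau>)
      then show ?thesis ..
    next
      case z: True
      then have "q \<tau> (d + \<delta>) \<noteq> 0" using True nz by (simp add: q_def \<tau> inner_simps inner_commute)
      then show ?thesis ..
    qed
  qed
  then obtain b where b: "q \<tau> b \<noteq> 0" ..
  have fin: "finite {t. q \<sigma> (a + t *\<^sub>R b) = 0}" if "\<sigma> \<in> insert \<tau> T" for \<sigma>
  proof -
    obtain \<delta> d s where \<sigma>: "\<sigma> = (\<delta>, d, s)" by (cases \<sigma>)
    \<comment> \<open>The constant coefficient is nonzero for the old conditions by the choice of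
      \<open>a\<close>, the leading one for the new condition by the choice of
      \<open>b\<close>.\<close>
    have "q \<sigma> (a + t *\<^sub>R b) = q \<sigma> a + t * (2 * (\<delta> \<bullet> d - s) * (a \<bullet> b)
        - 2 * ((a \<bullet> d) * (b \<bullet> \<delta>) + (b \<bullet> d) * (a \<bullet> \<delta>))) + t\<^sup>2 * q \<sigma> b" for t
      by (simp add: \<sigma> q_def inner_simps inner_commute algebra_simps power2_eq_square)
    then show ?thesis
      using finite_quadratic_roots[of "q \<sigma> a" "q \<sigma> b"] a b that by auto
  qed
  have "finite (\<Union>\<sigma>\<in>insert \<tau> T. {t. q \<sigma> (a + t *\<^sub>R b) = 0})"
    using insert.hyps(1) fin by blast
  then obtain t where "t \<notin> (\<Union>\<sigma>\<in>insert \<tau> T. {t. q \<sigma> (a + t *\<^sub>R b) = 0})"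
    using ex_new_if_finite[OF infinite_UNIV_char_0] by blast
  then have "\<forall>\<sigma>\<in>insert \<tau> T. q \<sigma> (a + t *\<^sub>R b) \<noteq> 0" by blast
  then show ?case unfolding q_def by (intro exI[of _ "a + t *\<^sub>R b"]) auto
qed

lemma exists_generic_orthogonal_transformation:
  fixes T :: "('a::euclidean_space \<times> 'a \<times> real) set"
  assumes "2 \<le> DIM('a)" and "finite T"
    and "\<forall>(\<delta>, d, s)\<in>T. \<delta> \<noteq> 0 \<and> d \<noteq> 0"
  obtains \<rho> :: "'a \<Rightarrow> 'a" where "orthogonal_transformation \<rho>"
    "\<forall>(\<delta>, d, s)\<in>T. \<delta> \<bullet> \<rho> d \<noteq> s"
proof -
  obtain a where a: "\<forall>(\<delta>, d, s)\<in>T. (\<delta> \<bullet> d - s) * (a \<bullet> a) - 2 * (a \<bullet> d) * (a \<bullet> \<delta>) \<noteq> 0"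
    using exists_generic_reflection_vector[OF assms] by blast
  have "\<delta> \<bullet> reflection a d \<noteq> s" if "(\<delta>, d, s) \<in> T" for \<delta> d s
  proof
    assume eq: "\<delta> \<bullet> reflection a d = s"
    \<comment> \<open>The form vanishes at 0, so a generic \<open>a\<close> is nonzero and the
      denominator in \<open>reflection\<close> can be cleared.\<close>
    have "a \<noteq> 0" using a that by auto
    then have "(\<delta> \<bullet> d - s) * (a \<bullet> a) - 2 * (a \<bullet> d) * (a \<bullet> \<delta>) = 0"
      unfolding eq[symmetric] reflection_def by (simp add: inner_simps field_simps inner_commute)
    then show False using a that by auto
  qed
  then show thesis using that orthogonal_transformation_reflection by blast
qed

section \<open>Grids, Hamming differences and generic embeddings\<close>

definition grid :: "nat \<Rightarrow> 'a set \<Rightarrow> (nat \<Rightarrow> 'a) set" where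
  "grid N X = {..<N} \<rightarrow>\<^sub>E X"

definition diff_coords :: "nat \<Rightarrow> (nat \<Rightarrow> 'a) \<Rightarrow> (nat \<Rightarrow> 'a) \<Rightarrow> nat set" where
  "diff_coords N x y = {i. i < N \<and> x i \<noteq> y i}"

lemma finite_grid: "finite X \<Longrightarrow> finite (grid N X)"
  by (simp add: grid_def finite_PiE)

lemma finite_diff_coords [simp]: "finite (diff_coords N x y)"
  by (simp add: diff_coords_def)

lemma grid_upd: "z \<in> grid N X \<Longrightarrow> j < N \<Longrightarrow> p \<in> X \<Longrightarrow> z(j := p) \<in> grid N X"
  by (auto simp: grid_def PiE_iff extensional_def)

lemma grid_eqI: "x \<in> grid N X \<Longrightarrow> y \<in> grid N X \<Longrightarrow> (\<And>i. i < N \<Longrightarrow> x i = y i) \<Longrightarrow> x = y"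
  unfolding grid_def by (rule PiE_ext) auto

text \<open>The second clause allows any function \<open>z\<close>, not only grid points: later a
  line is represented by a base function whose value in the direction of the line is
  \<open>undefined\<close>.\<close>

definition generic_grid_map :: "nat \<Rightarrow> 'a::real_normed_vector set \<Rightarrow> ((nat \<Rightarrow> 'a) \<Rightarrow> 'a) \<Rightarrow> bool" where
  "generic_grid_map N X \<phi> \<longleftrightarrow> inj_on \<phi> (grid N X) \<and>
     (\<forall>z j p q. j < N \<longrightarrow> norm (\<phi> (z(j := p)) - \<phi> (z(j := q))) = norm (p - q)) \<and>
     (\<forall>x\<in>grid N X. \<forall>y\<in>grid N X. 2 \<le> card (diff_coords N x y) \<longrightarrow> norm (\<phi> x - \<phi> y) \<noteq> 1)"

lemma exists_generic_orthogonal_sum: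
  fixes X :: "'a::euclidean_space set"
  assumes dim: "2 \<le> DIM('a)" and "finite X"
  shows "\<exists>\<rho> :: nat \<Rightarrow> 'a \<Rightarrow> 'a. (\<forall>j. orthogonal_transformation (\<rho> j)) \<and>
     (\<forall>x\<in>grid N X. \<forall>y\<in>grid N X. x \<noteq> y \<longrightarrow>
       (\<Sum>j<N. \<rho> j (x j - y j)) \<noteq> 0 \<and>
       (2 \<le> card (diff_coords N x y) \<longrightarrow> norm (\<Sum>j<N. \<rho> j (x j - y j)) \<noteq> 1))"
proof (induction N)
  case 0
  have "orthogonal_transformation (\<lambda>x::'a. x)" (is ?id)
    by (simp add: orthogonal_transformation_def linear_id[unfolded id_def])
  show ?case
    by (rule exI[of _ "\<lambda>(_::nat) (x::'a). x"]) (simp add: grid_def \<open>?id\<close>)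
next
  case (Suc N)
  then obtain \<rho> :: "nat \<Rightarrow> 'a \<Rightarrow> 'a" where "(\<forall>j. orthogonal_transformation (\<rho> j)) \<and>
     (\<forall>x\<in>grid N X. \<forall>y\<in>grid N X. x \<noteq> y \<longrightarrow>
       (\<Sum>j<N. \<rho> j (x j - y j)) \<noteq> 0 \<and>
       (2 \<le> card (diff_coords N x y) \<longrightarrow> norm (\<Sum>j<N. \<rho> j (x j - y j)) \<noteq> 1))" ..
  then have \<rho>: "\<And>j. orthogonal_transformation (\<rho> j)"
    and ne: "\<And>x y. x \<in> grid N X \<Longrightarrow> y \<in> grid N X \<Longrightarrow> x \<noteq> y \<Longrightarrow> (\<Sum>j<N. \<rho> j (x j - y j)) \<noteq> 0"
    and ne1: "\<And>x y. x \<in> grid N X \<Longrightarrow> y \<in> grid N X \<Longrightarrow> x \<noteq> y \<Longrightarrow> 2 \<le> card (diff_coords N x y) \<Longrightarrow>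
       norm (\<Sum>j<N. \<rho> j (x j - y j)) \<noteq> 1"
    by auto
  define D where "D = (\<lambda>(x, y). \<Sum>j<N. \<rho> j (x j - y j)) ` (grid N X \<times> grid N X) - {0}"
  define E where "E = (\<lambda>(p, q). p - q) ` (X \<times> X) - {0}"
  \<comment> \<open>Expanding the square of the norm of \<open>\<delta> + R d\<close> shows that
    lengths 1 and 0 each correspond to one forbidden value of \<open>\<delta> \<bullet> R d\<close>;
    these are the two values listed.\<close>
  define T where "T = (\<lambda>(\<delta>, d). (\<delta>, d, (1 - \<delta> \<bullet> \<delta> - d \<bullet> d) / 2)) ` (D \<times> E) \<union>
                      (\<lambda>(\<delta>, d). (\<delta>, d, (- (\<delta> \<bullet> \<delta>) - d \<bullet> d) / 2)) ` (D \<times> E)"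
  have "finite T" unfolding T_def D_def E_def using finite_grid[OF \<open>finite X\<close>] \<open>finite X\<close> by auto
  moreover have "\<forall>(\<delta>, d, s)\<in>T. \<delta> \<noteq> 0 \<and> d \<noteq> 0"
    by (auto simp: T_def D_def E_def)
  ultimately obtain R :: "'a \<Rightarrow> 'a" where R: "orthogonal_transformation R"
    and RT: "\<forall>(\<delta>, d, s)\<in>T. \<delta> \<bullet> R d \<noteq> s"
    by (rule exists_generic_orthogonal_transformation[OF dim])
  have lin: "linear R" and norm_R: "R v \<bullet> R v = v \<bullet> v" for v
    using R by (auto simp: orthogonal_transformation_def)
  have sq: "(\<delta> + R d) \<bullet> (\<delta> + R d) = \<delta> \<bullet> \<delta> + d \<bullet> d + 2 * (\<delta> \<bullet> R d)" for \<delta> d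
    by (simp add: inner_simps norm_R inner_commute)
  have gen: "\<delta> + R d \<noteq> 0 \<and> norm (\<delta> + R d) \<noteq> 1" if "\<delta> \<in> D" "d \<in> E" for \<delta> d
  proof -
    have "(\<delta>, d, (1 - \<delta> \<bullet> \<delta> - d \<bullet> d) / 2) \<in> T" "(\<delta>, d, (- (\<delta> \<bullet> \<delta>) - d \<bullet> d) / 2) \<in> T"
      using that by (auto simp: T_def image_iff)
    then have "\<delta> \<bullet> R d \<noteq> (1 - \<delta> \<bullet> \<delta> - d \<bullet> d) / 2" "\<delta> \<bullet> R d \<noteq> (- (\<delta> \<bullet> \<delta>) - d \<bullet> d) / 2"
      using RT by auto
    then have "(\<delta> + R d) \<bullet> (\<delta> + R d) \<noteq> 1" "(\<delta> + R d) \<bullet> (\<delta> + R d) \<noteq> 0"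
      unfolding sq by auto
    then show ?thesis by (auto simp: dot_square_norm)
  qed
  have "(\<Sum>j<Suc N. (\<rho>(N := R)) j (x j - y j)) \<noteq> 0 \<and>
       (2 \<le> card (diff_coords (Suc N) x y) \<longrightarrow> norm (\<Sum>j<Suc N. (\<rho>(N := R)) j (x j - y j)) \<noteq> 1)"
    if x: "x \<in> grid (Suc N) X" and y: "y \<in> grid (Suc N) X" and "x \<noteq> y" for x y
  proof -
    define x' where "x' = restrict x {..<N}"
    define y' where "y' = restrict y {..<N}"
    have x': "x' \<in> grid N X" "y' \<in> grid N X"
      using x y by (auto simp: x'_def y'_def grid_def PiE_iff)
    define \<delta> where "\<delta> = (\<Sum>j<N. \<rho> j (x' j - y' j))"
    have sum: "(\<Sum>j<Suc N. (\<rho>(N := R)) j (x j - y j)) = \<delta> + R (x N - y N)"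
      by (simp add: \<delta>_def x'_def y'_def)
    have diff: "diff_coords (Suc N) x y = diff_coords N x' y' \<union> (if x N = y N then {} else {N})"
      by (auto simp: diff_coords_def x'_def y'_def less_Suc_eq)
    show ?thesis
    proof (cases "x N = y N")
      case True
      then have "x' \<noteq> y'"
        using \<open>x \<noteq> y\<close> grid_eqI[OF x y] unfolding x'_def y'_def
        by (metis lessThan_iff less_Suc_eq restrict_apply')
      then show ?thesis
        using ne[OF x'] ne1[OF x'] True unfolding sum diff by (simp add: \<delta>_def linear_0[OF lin])
    next
      case False
      have N: "x N \<in> X" "y N \<in> X" using x y by (auto simp: grid_def)
      then have d: "x N - y N \<in> E" using False by (force simp: E_def)
      show ?thesis
      proof (cases "x' = y'")
        case True
        \<comment> \<open>Only coordinate \<open>N\<close> differs here, so length 1 is permitted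
          and only nonvanishing has to be shown.\<close>
        have "R (x N - y N) \<noteq> 0" using norm_R[of "x N - y N"] False by auto
        then show ?thesis unfolding sum diff using True by (simp add: \<delta>_def diff_coords_def linear_0[OF orthogonal_transformation_linear[OF \<rho>]])
      next
        case False
        then have "\<delta> \<in> D" using ne[OF x'] x' by (force simp: D_def \<delta>_def)
        then show ?thesis using gen[OF _ d] unfolding sum by blast
      qed
    qed
  qed
  then show ?case using \<rho> R by (intro exI[of _ "\<rho>(N := R)"]) auto
qed

lemma exists_generic_grid_map:
  fixes X :: "'a::euclidean_space set"
  assumes "2 \<le> DIM('a)" and "finite X"
  obtains \<phi> where "generic_grid_map N X \<phi>"
proof -
  obtain \<rho> :: "nat \<Rightarrow> 'a \<Rightarrow> 'a" where "(\<forall>j. orthogonal_transformation (\<rho> j)) \<and>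
     (\<forall>x\<in>grid N X. \<forall>y\<in>grid N X. x \<noteq> y \<longrightarrow>
       (\<Sum>j<N. \<rho> j (x j - y j)) \<noteq> 0 \<and>
       (2 \<le> card (diff_coords N x y) \<longrightarrow> norm (\<Sum>j<N. \<rho> j (x j - y j)) \<noteq> 1))"
    using exists_generic_orthogonal_sum[OF assms, of N] ..
  then have \<rho>: "\<And>j. orthogonal_transformation (\<rho> j)"
    and gen: "\<And>x y. x \<in> grid N X \<Longrightarrow> y \<in> grid N X \<Longrightarrow> x \<noteq> y \<Longrightarrow>
       (\<Sum>j<N. \<rho> j (x j - y j)) \<noteq> 0 \<and>
       (2 \<le> card (diff_coords N x y) \<longrightarrow> norm (\<Sum>j<N. \<rho> j (x j - y j)) \<noteq> 1)"
    by auto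
  define \<phi> where "\<phi> x = (\<Sum>j<N. \<rho> j (x j))" for x
  have diff: "\<phi> x - \<phi> y = (\<Sum>j<N. \<rho> j (x j - y j))" for x y
    using \<rho> by (simp add: \<phi>_def sum_subtractf linear_diff orthogonal_transformation_linear)
  have "norm (\<phi> (z(j := p)) - \<phi> (z(j := q))) = norm (p - q)" if "j < N" for z j p q
  proof -
    have "\<rho> i ((z(j := p)) i - (z(j := q)) i) = (if i = j then \<rho> j (p - q) else 0)" for i
      using \<rho> by (auto simp: linear_0 orthogonal_transformation_linear)
    then have "\<phi> (z(j := p)) - \<phi> (z(j := q)) = \<rho> j (p - q)"
      unfolding diff using that by simp
    then show ?thesis using \<rho> by (simp add: orthogonal_transformation_norm)
  qed
  moreover have "inj_on \<phi> (grid N X)"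
  proof (rule inj_onI, rule ccontr)
    fix x y assume "x \<in> grid N X" "y \<in> grid N X" "\<phi> x = \<phi> y" "x \<noteq> y"
    then show False using gen[of x y] diff[of x y] by simp
  qed
  moreover have "norm (\<phi> x - \<phi> y) \<noteq> 1"
    if "x \<in> grid N X" "y \<in> grid N X" "2 \<le> card (diff_coords N x y)" for x y
  proof -
    have "x \<noteq> y" using that(3) by (auto simp: diff_coords_def)
    then show ?thesis using gen[OF that(1,2)] that(3) unfolding diff by blast
  qed
  ultimately have "generic_grid_map N X \<phi>" unfolding generic_grid_map_def by blast
  then show thesis by (rule that)
qed

section \<open>Dense subcubes of a coloured grid\<close>

definition unit_embedding :: "bool \<Rightarrow> 'v graph \<Rightarrow> ('v \<Rightarrow> 'a::real_normed_vector) \<Rightarrow> bool" where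
  "unit_embedding ind H g \<longleftrightarrow> inj_on g (verts H) \<and>
     (\<forall>x \<in> verts H. \<forall>y \<in> verts H. {x, y} \<in> edges H \<longrightarrow> norm (g x - g y) = 1) \<and>
     (ind \<longrightarrow> (\<forall>x \<in> verts H. \<forall>y \<in> verts H. {x, y} \<notin> edges H \<longrightarrow> norm (g x - g y) \<noteq> 1))"

definition avoids :: "bool \<Rightarrow> 'v graph \<Rightarrow> ('a::real_normed_vector \<Rightarrow> nat) \<Rightarrow> bool" where
  "avoids ind H c \<longleftrightarrow> \<not> (\<exists>g. unit_embedding ind H g \<and> monochromatic c (g ` verts H))"

lemma unit_copy_iff: "unit_copy H A \<longleftrightarrow> (\<exists>g. unit_embedding False H g \<and> A = g ` verts H)"
  unfolding unit_copy_def unit_embedding_def bij_betw_def by auto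

lemma induced_unit_copy_iff:
  "induced_unit_copy H A \<longleftrightarrow> (\<exists>g. unit_embedding True H g \<and> A = g ` verts H)"
  unfolding induced_unit_copy_def unit_embedding_def bij_betw_def by auto

text \<open>In this form, two such numbers agree, be they finite or infinite, as soon as for every
  \<open>r\<close> the existence of the two kinds of \<open>r\<close>-colouring is
  equivalent.\<close>

lemma chi_copy_UNIV:
  "chi_copy H (UNIV :: 'a::real_normed_vector set) =
     (INF r \<in> {r. \<exists>c :: 'a \<Rightarrow> nat. c \<in> UNIV \<rightarrow> {..<r} \<and> avoids False H c}. enat r)"
proof -
  have "(\<exists>A\<subseteq>UNIV. unit_copy H A \<and> monochromatic c A) \<longleftrightarrow> \<not> avoids False H c" for c :: "'a \<Rightarrow> nat"
    unfolding avoids_def unit_copy_iff by auto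
  then show ?thesis unfolding chi_copy_def by simp
qed

lemma chi_ind_copy_UNIV:
  "chi_ind_copy H (UNIV :: 'a::real_normed_vector set) =
     (INF r \<in> {r. \<exists>c :: 'a \<Rightarrow> nat. c \<in> UNIV \<rightarrow> {..<r} \<and> avoids True H c}. enat r)"
proof -
  have "(\<exists>A\<subseteq>UNIV. induced_unit_copy H A \<and> monochromatic c A) \<longleftrightarrow> \<not> avoids True H c"
    for c :: "'a \<Rightarrow> nat"
    unfolding avoids_def induced_unit_copy_iff by auto
  then show ?thesis unfolding chi_ind_copy_def by simp
qed

lemma finite_unavoidable_set:
  fixes H :: "'v graph"
  assumes "finite (verts H)" "0 < r"
    and "\<And>c :: 'a::real_normed_vector \<Rightarrow> nat. c \<in> UNIV \<rightarrow> {..<r} \<Longrightarrow> \<not> avoids ind H c"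
  obtains X :: "'a::real_normed_vector set" where "finite X"
    "\<And>c. c \<in> X \<rightarrow> {..<r} \<Longrightarrow>
       \<exists>g i. unit_embedding ind H g \<and> g ` verts H \<subseteq> X \<and> (\<forall>w\<in>verts H. c (g w) = i)"
proof -
  obtain X :: "'a set" where X: "finite X"
    "\<And>c. c \<in> X \<rightarrow> {..<r} \<Longrightarrow>
      \<exists>A\<in>{g ` verts H | g. unit_embedding ind H g}. A \<subseteq> X \<and> monochromatic c A"
  proof (rule colouring_compactness[of r "{g ` verts H | g :: 'v \<Rightarrow> 'a. unit_embedding ind H g}"])
    show "0 < r" by fact
    show "finite A" if "A \<in> {g ` verts H | g :: 'v \<Rightarrow> 'a. unit_embedding ind H g}" for A
      using that assms(1) by auto
    show "\<exists>A\<in>{g ` verts H | g. unit_embedding ind H g}. monochromatic c A"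
      if "c \<in> UNIV \<rightarrow> {..<r}" for c :: "'a \<Rightarrow> nat"
      using assms(3)[OF that] unfolding avoids_def by blast
  qed blast
  show thesis
  proof (rule that[OF X(1)])
    fix c :: "'a \<Rightarrow> nat" assume "c \<in> X \<rightarrow> {..<r}"
    then obtain g where "unit_embedding ind H g" "g ` verts H \<subseteq> X" "monochromatic c (g ` verts H)"
      using X(2) by blast
    then show "\<exists>g i. unit_embedding ind H g \<and> g ` verts H \<subseteq> X \<and> (\<forall>w\<in>verts H. c (g w) = i)"
      unfolding monochromatic_def by blast
  qed
qed

section \<open>Edges of the hypercube\<close>

lemma finite_cube_verts: "finite (cube_verts N)"
  unfolding cube_verts_def by (intro finite_PiE) auto

lemma finite_edges_hypercube: "finite (edges (hypercube N))"
proof (rule finite_subset)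
  show "edges (hypercube N) \<subseteq> Pow (cube_verts N)" by (auto simp: hypercube_def)
qed (simp add: finite_cube_verts)

lemma edge_hypercube_iff:
  assumes "x \<in> cube_verts N" "y \<in> cube_verts N"
  shows "{x, y} \<in> edges (hypercube N) \<longleftrightarrow> card (diff_coords N x y) = 1"
proof -
  have "diff_coords N x y = diff_coords N y x" for x y :: "nat \<Rightarrow> nat"
    by (auto simp: diff_coords_def)
  then show ?thesis
    using assms by (auto simp: hypercube_def doubleton_eq_iff simp flip: diff_coords_def)
qed

text \<open>The pair \<open>(j, \<epsilon>)\<close> encodes the edge of the hypercube from \<open>\<epsilon>\<close> upwards in direction \<open>j\<close>.\<close>

definition up_edges :: "nat \<Rightarrow> (nat \<times> (nat \<Rightarrow> nat)) set" where
  "up_edges N = {(j, \<epsilon>). j < N \<and> \<epsilon> \<in> cube_verts N \<and> \<epsilon> j = 0}"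

definition up_edge :: "nat \<times> (nat \<Rightarrow> nat) \<Rightarrow> (nat \<Rightarrow> nat) set" where
  "up_edge = (\<lambda>(j, \<epsilon>). {\<epsilon>, \<epsilon>(j := 1)})"

lemma finite_up_edges: "finite (up_edges N)"
  by (rule finite_subset[of _ "{..<N} \<times> cube_verts N"]) (auto simp: up_edges_def finite_cube_verts)

lemma cube_verts_upd: "\<epsilon> \<in> cube_verts N \<Longrightarrow> j < N \<Longrightarrow> b \<in> {0, 1} \<Longrightarrow> \<epsilon>(j := b) \<in> cube_verts N"
  by (auto simp: cube_verts_def PiE_iff extensional_def)

lemma inj_on_up_edge: "inj_on up_edge (up_edges N)"
proof (rule inj_onI)
  fix e e' assume e: "e \<in> up_edges N" "e' \<in> up_edges N" "up_edge e = up_edge e'"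
  obtain j \<epsilon> j' \<epsilon>' where ee: "e = (j, \<epsilon>)" "e' = (j', \<epsilon>')" by (cases e, cases e')
  have z: "\<epsilon> j = 0" "\<epsilon>' j' = 0" using e by (auto simp: ee up_edges_def)
  from e(3) consider "\<epsilon> = \<epsilon>'" "\<epsilon>(j := 1) = \<epsilon>'(j' := 1)" | "\<epsilon> = \<epsilon>'(j' := 1)" "\<epsilon>(j := 1) = \<epsilon>'"
    unfolding ee up_edge_def by (auto simp: doubleton_eq_iff)
  then show "e = e'"
  proof cases
    case 1
    then have "(\<epsilon>(j' := 1)) j = 1" by (metis fun_upd_same)
    then show ?thesis using 1 z by (auto simp: ee split: if_splits)
  next
    case 2
    have "\<epsilon> j' = 1" by (simp add: 2(1))
    moreover have "(\<epsilon>(j := 1)) j' = 0" unfolding 2(2) by (rule z)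
    ultimately show ?thesis by (auto split: if_splits)
  qed
qed

lemma up_edge_image: "up_edge ` up_edges N = edges (hypercube N)"
proof (intro set_eqI iffI)
  fix e assume "e \<in> up_edge ` up_edges N"
  then obtain j \<epsilon> where e: "e = {\<epsilon>, \<epsilon>(j := 1)}" "j < N" "\<epsilon> \<in> cube_verts N" "\<epsilon> j = 0"
    by (auto simp: up_edge_def up_edges_def)
  then have "diff_coords N \<epsilon> (\<epsilon>(j := 1)) = {j}" by (auto simp: diff_coords_def)
  then show "e \<in> edges (hypercube N)"
    unfolding e(1) using e by (subst edge_hypercube_iff) (auto intro: cube_verts_upd)
next
  fix e assume "e \<in> edges (hypercube N)"
  then obtain x y where e: "e = {x, y}" "x \<in> cube_verts N" "y \<in> cube_verts N"
    "card (diff_coords N x y) = 1"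
    by (auto simp: hypercube_def diff_coords_def)
  then obtain j where j: "diff_coords N x y = {j}" by (auto simp: card_1_singleton_iff)
  then have jN: "j < N" "x j \<noteq> y j" by (auto simp: diff_coords_def)
  have eq: "x i = y i" if "i \<noteq> j" for i
  proof (cases "i < N")
    case True
    then show ?thesis using j that by (auto simp: diff_coords_def)
  next
    case False
    then show ?thesis using e by (simp add: cube_verts_def PiE_iff extensional_def)
  qed
  have "x j \<in> {0, 1}" "y j \<in> {0, 1}" using e jN by (auto simp: cube_verts_def PiE_iff)
  with jN consider "x j = 0" "y j = 1" | "x j = 1" "y j = 0" by auto
  then show "e \<in> up_edge ` up_edges N"
  proof cases
    case 1
    then have "y = x(j := 1)" using eq by auto
    then have "e = up_edge (j, x)" by (simp add: e up_edge_def)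
    then show ?thesis using 1 e jN by (auto simp: up_edges_def)
  next
    case 2
    then have "x = y(j := 1)" using eq by auto
    then have "e = up_edge (j, y)" by (auto simp: e up_edge_def)
    then show ?thesis using 2 e jN by (auto simp: up_edges_def)
  qed
qed

lemma card_edges_hypercube: "card (edges (hypercube N)) = card (up_edges N)"
  using card_image[OF inj_on_up_edge] by (simp add: up_edge_image)

lemma card_edges_hypercube_pos: "0 < N \<Longrightarrow> 0 < card (edges (hypercube N))"
proof -
  assume "0 < N"
  then have "(0, \<lambda>i\<in>{..<N}. 0) \<in> up_edges N" by (auto simp: up_edges_def cube_verts_def)
  then show ?thesis unfolding card_edges_hypercube using finite_up_edges card_gt_0_iff by blast
qed

text \<open>A combinatorial cube inside the grid: \<open>s\<close> offers two values in every
  coordinate and the bits choose between them. Bit 1 takes the first component, so for edge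
  replacements the upper end of a cube edge is the place of \<open>u\<close> and the lower end that
  of \<open>v\<close>.\<close>

definition subcube :: "nat \<Rightarrow> (nat \<Rightarrow> 'a \<times> 'a) \<Rightarrow> (nat \<Rightarrow> nat) \<Rightarrow> nat \<Rightarrow> 'a" where
  "subcube N s \<epsilon> = (\<lambda>j\<in>{..<N}. if \<epsilon> j = 1 then fst (s j) else snd (s j))"

lemma subcube_in_grid:
  assumes "s \<in> grid N P" "P \<subseteq> X \<times> X"
  shows "subcube N s \<epsilon> \<in> grid N X"
proof -
  have "s j \<in> X \<times> X" if "j < N" for j using assms that by (auto simp: grid_def)
  then show ?thesis by (auto simp: subcube_def grid_def mem_Times_iff)
qed

lemma subcube_upd:
  "j < N \<Longrightarrow> subcube N s (\<epsilon>(j := b)) = (subcube N s \<epsilon>)(j := if b = 1 then fst (s j) else snd (s j))"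
  by (auto simp: subcube_def fun_eq_iff)

lemma diff_coords_subcube:
  assumes "\<epsilon> \<in> cube_verts N" "\<epsilon>' \<in> cube_verts N" "\<And>j. j < N \<Longrightarrow> fst (s j) \<noteq> snd (s j)"
  shows "diff_coords N (subcube N s \<epsilon>) (subcube N s \<epsilon>') = diff_coords N \<epsilon> \<epsilon>'"
proof -
  have "\<epsilon> i \<in> {0, 1}" "\<epsilon>' i \<in> {0, 1}" if "i < N" for i
    using assms that by (auto simp: cube_verts_def PiE_iff)
  then show ?thesis
    using assms(3) unfolding diff_coords_def subcube_def
    by (intro Collect_cong) (auto; metis zero_neq_one)
qed

lemma inj_on_subcube:
  assumes "\<And>j. j < N \<Longrightarrow> fst (s j) \<noteq> snd (s j)"
  shows "inj_on (subcube N s) (cube_verts N)"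
proof (rule inj_onI)
  fix x y assume xy: "x \<in> cube_verts N" "y \<in> cube_verts N" "subcube N s x = subcube N s y"
  then have "diff_coords N x y = {}"
    using diff_coords_subcube[of x N y s] assms by (auto simp: diff_coords_def)
  then show "x = y" using xy(1,2) unfolding cube_verts_def diff_coords_def
    by (auto intro: PiE_ext)
qed

text \<open>Double counting: for a random choice of \<open>s\<close>, an edge in direction \<open>j\<close> becomes good with
  probability at least \<open>1 / card P\<close>, because the line through it only depends on the other
  coordinates of \<open>s\<close>.\<close>

lemma exists_dense_subcube:
  fixes P :: "('a \<times> 'a) set"
  assumes "finite P" "P \<noteq> {}" "P \<subseteq> X \<times> X" "0 < r"
    and line: "\<And>j z. j < N \<Longrightarrow> z \<in> grid N X \<Longrightarrow>
      \<exists>p q i. (p, q) \<in> P \<and> i < r \<and> Good i j (z(j := p)) (z(j := q))"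
  obtains s i where "s \<in> grid N P" "i < r"
    "card (up_edges N) \<le> card P * r *
       card {(j, \<epsilon>) \<in> up_edges N. Good i j (subcube N s (\<epsilon>(j := 1))) (subcube N s \<epsilon>)}"
proof -
  define good where "good = (\<lambda>(s, i) (j, \<epsilon>). Good i j (subcube N s (\<epsilon>(j := 1))) (subcube N s \<epsilon>))"
  define I where "I = grid N P \<times> {..<r}"
  have finI: "finite I" "I \<noteq> {}"
    using assms finite_grid[of P N] by (auto simp: I_def grid_def PiE_eq_empty_iff)
  have key: "card (grid N P) \<le> card {a\<in>I. good a e} * card P" if eN: "e \<in> up_edges N" for e
  proof -
    obtain j \<epsilon> where e: "e = (j, \<epsilon>)" "j < N" "\<epsilon> \<in> cube_verts N" "\<epsilon> j = 0"
      using eN by (auto simp: up_edges_def)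
    obtain x0 where x0: "x0 \<in> X" using assms by auto
    \<comment> \<open>A base point of the line that contains the image of the edge \<open>e\<close>.
      Overwriting coordinate \<open>j\<close> makes it independent of \<open>s j\<close>.\<close>
    define Z where "Z s = (subcube N s \<epsilon>)(j := x0)" for s
    have Z: "Z s \<in> grid N X" if "s \<in> grid N P" for s
      unfolding Z_def using subcube_in_grid[OF that] assms x0 e by (intro grid_upd) auto
    obtain p q i where pqi: "\<And>z. z \<in> grid N X \<Longrightarrow>
        (p z, q z) \<in> P \<and> i z < r \<and> Good (i z) j (z(j := p z)) (z(j := q z))"
      using line[OF e(2)] by metis
    \<comment> \<open>Replacing \<open>s j\<close> by the good pair of its line makes the edge good.
      Keeping the old \<open>s j\<close> as a second component makes the map injective, and this is
      where the factor \<open>card P\<close> comes from.\<close>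
    define f where "f s = ((s(j := (p (Z s), q (Z s))), i (Z s)), s j)" for s
    have "good (s(j := (p (Z s), q (Z s))), i (Z s)) e" if "s \<in> grid N P" for s
    proof -
      have "subcube N (s(j := (p (Z s), q (Z s)))) (\<epsilon>(j := 1)) = (Z s)(j := p (Z s))"
        "subcube N (s(j := (p (Z s), q (Z s)))) \<epsilon> = (Z s)(j := q (Z s))"
        using e by (auto simp: subcube_def Z_def fun_eq_iff)
      then show ?thesis using pqi[OF Z[OF that]] by (simp add: good_def e)
    qed
    then have "f ` grid N P \<subseteq> {a\<in>I. good a e} \<times> P"
      using pqi Z e by (auto simp: f_def I_def grid_def PiE_iff extensional_def)
    moreover have "inj_on f (grid N P)"
    proof (rule inj_onI)
      fix s s' assume "f s = f s'"
      then show "s = s'" unfolding f_def by (metis fun_upd_triv fun_upd_upd prod.inject)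
    qed
    moreover have "finite ({a\<in>I. good a e} \<times> P)" using finI assms by auto
    ultimately have "card (grid N P) \<le> card ({a\<in>I. good a e} \<times> P)"
      using card_inj_on_le by blast
    then show ?thesis by (simp add: card_cartesian_product)
  qed
  have swap: "(\<Sum>e\<in>up_edges N. card {a\<in>I. good a e}) = (\<Sum>a\<in>I. card {e\<in>up_edges N. good a e})"
  proof -
    have "(\<Sum>e\<in>up_edges N. card {a\<in>I. good a e}) = (\<Sum>e\<in>up_edges N. \<Sum>a\<in>I. of_bool (good a e))"
      using finI by (intro sum.cong) (auto simp: Int_def)
    also have "\<dots> = (\<Sum>a\<in>I. \<Sum>e\<in>up_edges N. of_bool (good a e))" by (rule sum.swap)
    also have "\<dots> = (\<Sum>a\<in>I. card {e\<in>up_edges N. good a e})"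
      using finite_up_edges by (intro sum.cong) (auto simp: Int_def)
    finally show ?thesis .
  qed
  \<comment> \<open>Averaging over all \<open>a\<close> in \<open>I\<close>. As \<open>I\<close> has
    \<open>r * card (grid N P)\<close> elements, letting the colour vary as well costs the factor
    \<open>r\<close>.\<close>
  have "\<exists>a\<in>I. card (up_edges N) \<le> card P * r * card {e\<in>up_edges N. good a e}"
  proof (rule ccontr)
    assume "\<not> ?thesis"
    then have "(\<Sum>a\<in>I. card P * r * card {e\<in>up_edges N. good a e}) < (\<Sum>a\<in>I. card (up_edges N))"
      using finI by (intro sum_strict_mono) (auto simp: not_le)
    also have "\<dots> = r * (card (up_edges N) * card (grid N P))"
      by (simp add: I_def card_cartesian_product)
    also have "\<dots> \<le> r * (\<Sum>e\<in>up_edges N. card {a\<in>I. good a e} * card P)"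
      using sum_mono[OF key, of "up_edges N"] by simp
    also have "\<dots> = (\<Sum>a\<in>I. card P * r * card {e\<in>up_edges N. good a e})"
      by (simp only: sum_distrib_right[symmetric] sum_distrib_left[symmetric] swap) (simp add: ac_simps)
    finally show False by simp
  qed
  then obtain s i where "(s, i) \<in> I"
    "card (up_edges N) \<le> card P * r * card {e\<in>up_edges N. good (s, i) e}" by auto
  moreover have "{e\<in>up_edges N. good (s, i) e} =
      {(j, \<epsilon>) \<in> up_edges N. Good i j (subcube N s (\<epsilon>(j := 1))) (subcube N s \<epsilon>)}"
    by (auto simp: good_def)
  ultimately show thesis using that[of s i] by (simp add: I_def)
qed

text \<open>The predicate \<open>Q\<close> stands for any of the three notions of containing a copy.
  A constant share \<open>1 / K\<close> of the edges eventually exceeds the extremal number because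
  \<open>K\<close> is fixed before \<open>N\<close>.\<close>

lemma exists_cube_above_extremal_number:
  assumes "(\<lambda>N. real (Max {card (edges G) | G. subgraph G (hypercube N) \<and> \<not> Q N G}) /
      real (card (edges (hypercube N)))) \<longlonglongrightarrow> 0" and "0 < K"
  obtains N where "\<And>G. subgraph G (hypercube N) \<Longrightarrow>
    card (edges (hypercube N)) \<le> K * card (edges G) \<Longrightarrow> Q N G"
proof -
  let ?ex = "\<lambda>N. Max {card (edges G) | G. subgraph G (hypercube N) \<and> \<not> Q N G}"
  have "\<forall>\<^sub>F N in sequentially. real (?ex N) / real (card (edges (hypercube N))) < 1 / real K"
    using assms by (intro order_tendstoD) auto
  then have "\<forall>\<^sub>F N in sequentially. 0 < N \<and>
      real (?ex N) / real (card (edges (hypercube N))) < 1 / real K"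
    using eventually_gt_at_top[of 0] by eventually_elim auto
  then obtain N where N: "0 < N" "real (?ex N) / real (card (edges (hypercube N))) < 1 / real K"
    using eventually_happens'[OF sequentially_bot] by (metis (no_types, lifting))
  then have "real (?ex N * K) < real (card (edges (hypercube N)))"
    using card_edges_hypercube_pos[OF N(1)] \<open>0 < K\<close> by (simp add: field_simps)
  then have lt: "K * ?ex N < card (edges (hypercube N))" by (simp only: of_nat_less_iff mult.commute)
  show thesis
  proof (rule that[of N], rule ccontr)
    fix G assume G: "subgraph G (hypercube N)" "card (edges (hypercube N)) \<le> K * card (edges G)" "\<not> Q N G"
    have "{card (edges G) | G. subgraph G (hypercube N) \<and> \<not> Q N G} \<subseteq> {..card (edges (hypercube N))}"
      by (auto simp: subgraph_def intro!: card_mono finite_edges_hypercube)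
    then have "finite {card (edges G) | G. subgraph G (hypercube N) \<and> \<not> Q N G}"
      using finite_subset by blast
    \<comment> \<open>The supposed counterexample \<open>G\<close> itself belongs to the set, so the
      maximum is taken over a nonempty finite set.\<close>
    then have "card (edges G) \<le> ?ex N" using G by (intro Max_ge) blast+
    then have "K * card (edges G) \<le> K * ?ex N" by simp
    then show False using lt G(2) by linarith
  qed
qed

section \<open>Graphs of zero hypercube density\<close>

text \<open>With a unit pair of \<open>X\<close> in every coordinate, the unit distance graph of the
  image is exactly the hypercube: cube edges have length 1 because lines are embedded isometrically,
  and all other pairs differ in at least two coordinates. The equivalence, rather than one
  implication, is what the induced case needs.\<close>

lemma dense_monochromatic_subcube:
  fixes c :: "'a::euclidean_space \<Rightarrow> nat"
  assumes dim: "2 \<le> DIM('a)" and c: "c \<in> UNIV \<rightarrow> {..<r}"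
    and bad: "\<And>c' :: 'a \<Rightarrow> nat. c' \<in> UNIV \<rightarrow> {..<r} \<Longrightarrow> \<exists>x y. norm (x - y) = 1 \<and> c' x = c' y"
  obtains K where "0 < K" and "\<And>N. \<exists>\<theta> i. inj_on \<theta> (cube_verts N) \<and>
      (\<forall>x\<in>cube_verts N. \<forall>y\<in>cube_verts N. {x, y} \<in> edges (hypercube N) \<longleftrightarrow> norm (\<theta> x - \<theta> y) = 1) \<and>
      card (edges (hypercube N)) \<le> K * card {e \<in> edges (hypercube N). \<forall>x\<in>e. c (\<theta> x) = i}"
proof -
  have r: "0 < r" using c by fastforce
  obtain X :: "'a set" where X: "finite X"
    "\<And>c'. c' \<in> X \<rightarrow> {..<r} \<Longrightarrow>
      \<exists>A\<in>{{x, y} | x y :: 'a. norm (x - y) = 1}. A \<subseteq> X \<and> monochromatic c' A"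
  proof (rule colouring_compactness[of r "{{x, y} | x y :: 'a. norm (x - y) = 1}"])
    show "0 < r" by fact
    show "finite A" if "A \<in> {{x, y} | x y :: 'a. norm (x - y) = 1}" for A using that by auto
    show "\<exists>A\<in>{{x, y} | x y. norm (x - y) = 1}. monochromatic c' A"
      if c': "c' \<in> UNIV \<rightarrow> {..<r}" for c' :: "'a \<Rightarrow> nat"
    proof -
      obtain x y where "norm (x - y) = 1" "c' x = c' y" using bad[OF c'] by blast
      then show ?thesis by (intro bexI[of _ "{x, y}"]) (auto simp: monochromatic_def)
    qed
  qed blast
  define P where "P = {(p, q) \<in> X \<times> X. norm (p - q) = 1}"
  have P: "finite P" "P \<subseteq> X \<times> X"
    using X(1) by (auto simp: P_def intro: finite_subset[of _ "X \<times> X"])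
  have pair: "\<exists>p q. (p, q) \<in> P \<and> c' p = c' q" if c': "c' \<in> X \<rightarrow> {..<r}" for c' :: "'a \<Rightarrow> nat"
  proof -
    obtain x y where "norm (x - y) = 1" "{x, y} \<subseteq> X" "monochromatic c' {x, y}"
      using X(2)[OF c'] by blast
    then have "(x, y) \<in> P \<and> c' x = c' y" by (auto simp: P_def monochromatic_def)
    then show ?thesis by blast
  qed
  have "P \<noteq> {}" using pair[of "\<lambda>_. 0"] r by auto
  have ne: "p \<noteq> q" if "(p, q) \<in> P" for p q using that by (auto simp: P_def)
  show thesis
  proof (rule that[of "card P * r"])
    show "0 < card P * r" using P \<open>P \<noteq> {}\<close> r by (simp add: card_gt_0_iff)
    fix N
    obtain \<phi> where \<phi>: "generic_grid_map N X \<phi>" using exists_generic_grid_map[OF dim X(1)] by blast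
    have "\<exists>p q i. (p, q) \<in> P \<and> i < r \<and> c (\<phi> (z(j := p))) = i \<and> c (\<phi> (z(j := q))) = i"
      if "j < N" "z \<in> grid N X" for j z
    proof -
      obtain p q where "(p, q) \<in> P" "c (\<phi> (z(j := p))) = c (\<phi> (z(j := q)))"
        using pair[of "\<lambda>p. c (\<phi> (z(j := p)))"] c by auto
      moreover have "c (\<phi> (z(j := q))) < r" using c by auto
      ultimately show ?thesis by blast
    qed
    then obtain s i where s: "s \<in> grid N P"
      and card: "card (up_edges N) \<le> card P * r * card {(j, \<epsilon>) \<in> up_edges N.
         c (\<phi> (subcube N s (\<epsilon>(j := 1)))) = i \<and> c (\<phi> (subcube N s \<epsilon>)) = i}"
      by (rule exists_dense_subcube[OF P(1) \<open>P \<noteq> {}\<close> P(2) r,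
            where Good = "\<lambda>i j x y. c (\<phi> x) = i \<and> c (\<phi> y) = i"])
    have sP: "(fst (s j), snd (s j)) \<in> P" if "j < N" for j using s that by (auto simp: grid_def)
    have sne: "fst (s j) \<noteq> snd (s j)" if "j < N" for j using ne sP[OF that] by blast
    define \<theta> where "\<theta> = \<phi> \<circ> subcube N s"
    have sub: "subcube N s \<epsilon> \<in> grid N X" for \<epsilon> by (rule subcube_in_grid[OF s P(2)])
    have inj: "inj_on \<theta> (cube_verts N)"
      unfolding \<theta>_def using \<phi> inj_on_subcube[OF sne] sub
      by (intro comp_inj_on) (auto simp: generic_grid_map_def intro: inj_on_subset)
    have up: "norm (\<theta> \<epsilon> - \<theta> (\<epsilon>(j := 1))) = 1" if "(j, \<epsilon>) \<in> up_edges N" for j \<epsilon>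
    proof -
      have j: "j < N" "\<epsilon> j = 0" using that by (auto simp: up_edges_def)
      have "subcube N s \<epsilon> = (subcube N s \<epsilon>)(j := snd (s j))"
        using j by (intro fun_upd_idem[symmetric]) (simp add: subcube_def)
      moreover have "subcube N s (\<epsilon>(j := 1)) = (subcube N s \<epsilon>)(j := fst (s j))"
        using subcube_upd[OF j(1), of s \<epsilon> 1] by simp
      ultimately have "norm (\<theta> \<epsilon> - \<theta> (\<epsilon>(j := 1))) =
          norm (\<phi> ((subcube N s \<epsilon>)(j := snd (s j))) - \<phi> ((subcube N s \<epsilon>)(j := fst (s j))))"
        unfolding \<theta>_def comp_apply by presburger
      also have "\<dots> = norm (snd (s j) - fst (s j))"
        using \<phi> j by (simp add: generic_grid_map_def)
      also have "\<dots> = 1"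
        using sP[OF j(1)] by (simp add: P_def case_prod_beta norm_minus_commute)
      finally show ?thesis .
    qed
    have iff: "{x, y} \<in> edges (hypercube N) \<longleftrightarrow> norm (\<theta> x - \<theta> y) = 1"
      if x: "x \<in> cube_verts N" and y: "y \<in> cube_verts N" for x y
    proof
      assume "{x, y} \<in> edges (hypercube N)"
      then obtain j \<epsilon> where e: "(j, \<epsilon>) \<in> up_edges N" "{x, y} = {\<epsilon>, \<epsilon>(j := 1)}"
        unfolding up_edge_image[symmetric] by (auto simp: up_edge_def)
      then show "norm (\<theta> x - \<theta> y) = 1"
        using up[OF e(1)] by (auto simp: doubleton_eq_iff norm_minus_commute)
    next
      assume 1: "norm (\<theta> x - \<theta> y) = 1"
      then have "\<not> 2 \<le> card (diff_coords N (subcube N s x) (subcube N s y))"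
        using \<phi> sub unfolding generic_grid_map_def \<theta>_def by auto
      then have "\<not> 2 \<le> card (diff_coords N x y)"
        using diff_coords_subcube[OF x y sne] by simp
      moreover have "diff_coords N x y \<noteq> {}"
      proof
        assume "diff_coords N x y = {}"
        then have "x = y" using x y unfolding cube_verts_def diff_coords_def by (auto intro: PiE_ext)
        then show False using 1 by simp
      qed
      then have "0 < card (diff_coords N x y)" by (simp add: card_gt_0_iff)
      ultimately have "card (diff_coords N x y) = 1" by linarith
      then show "{x, y} \<in> edges (hypercube N)" using edge_hypercube_iff[OF x y] by simp
    qed
    have "up_edge ` {(j, \<epsilon>) \<in> up_edges N. c (\<phi> (subcube N s (\<epsilon>(j := 1)))) = i \<and> c (\<phi> (subcube N s \<epsilon>)) = i}
        \<subseteq> {e \<in> edges (hypercube N). \<forall>x\<in>e. c (\<theta> x) = i}"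
      using up_edge_image[of N] by (auto simp: up_edge_def \<theta>_def)
    then have "card {(j, \<epsilon>) \<in> up_edges N. c (\<phi> (subcube N s (\<epsilon>(j := 1)))) = i \<and> c (\<phi> (subcube N s \<epsilon>)) = i}
        \<le> card {e \<in> edges (hypercube N). \<forall>x\<in>e. c (\<theta> x) = i}"
      using finite_edges_hypercube
      by (intro card_inj_on_le[where f = up_edge] inj_on_subset[OF inj_on_up_edge]) auto
    then have "card (edges (hypercube N)) \<le> card P * r * card {e \<in> edges (hypercube N). \<forall>x\<in>e. c (\<theta> x) = i}"
      using card unfolding card_edges_hypercube by (meson le_trans mult_le_mono2)
    then show "\<exists>\<theta> i. inj_on \<theta> (cube_verts N) \<and>
      (\<forall>x\<in>cube_verts N. \<forall>y\<in>cube_verts N. {x, y} \<in> edges (hypercube N) \<longleftrightarrow> norm (\<theta> x - \<theta> y) = 1) \<and>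
      card (edges (hypercube N)) \<le> card P * r * card {e \<in> edges (hypercube N). \<forall>x\<in>e. c (\<theta> x) = i}"
      using inj iff by blast
  qed
qed

text \<open>Merges the two containments under one flag, so that a single argument treats both
  densities.\<close>

definition cube_contains :: "bool \<Rightarrow> (nat \<Rightarrow> nat) graph \<Rightarrow> 'v graph \<Rightarrow> bool" where
  "cube_contains ind G H \<longleftrightarrow> (if ind then contains_induced_copy G H else contains_copy G H)"

lemma cube_contains_embedding:
  assumes "cube_contains ind G H" "simple_graph H"
  obtains f where "inj_on f (verts H)" "f ` verts H \<subseteq> verts G"
    "\<And>x y. x \<in> verts H \<Longrightarrow> y \<in> verts H \<Longrightarrow> {x, y} \<in> edges H \<Longrightarrow> {f x, f y} \<in> edges G"
    "\<And>x y. ind \<Longrightarrow> x \<in> verts H \<Longrightarrow> y \<in> verts H \<Longrightarrow> {x, y} \<notin> edges H \<Longrightarrow> {f x, f y} \<notin> edges G"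
proof -
  obtain K f where K: "if ind then induced_subgraph K G else subgraph K G" and f: "graph_iso f H K"
    using assms by (auto simp: cube_contains_def contains_copy_def contains_induced_copy_def copy_of_def
        split: if_splits)
  have inj: "inj_on f (verts H)" and im: "f ` verts H = verts K" and ed: "edges K = (\<lambda>e. f ` e) ` edges H"
    using f by (auto simp: graph_iso_def bij_betw_def)
  show thesis
  proof (rule that[OF inj])
    show "f ` verts H \<subseteq> verts G"
      using K im by (auto simp: subgraph_def induced_subgraph_def split: if_splits)
    show "{f x, f y} \<in> edges G" if "{x, y} \<in> edges H" for x y
    proof -
      have "{f x, f y} \<in> edges K" unfolding ed using imageI[OF that, of "\<lambda>e. f ` e"] by simp
      then show ?thesis using K by (auto simp: subgraph_def induced_subgraph_def split: if_splits)
    qed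
    show "{f x, f y} \<notin> edges G"
      if ind and xy: "x \<in> verts H" "y \<in> verts H" "{x, y} \<notin> edges H" for x y
    proof
      assume "{f x, f y} \<in> edges G"
      then have "{f x, f y} \<in> edges K"
        using K \<open>ind\<close> im xy by (auto simp: induced_subgraph_def)
      then obtain e where e: "e \<in> edges H" "f ` e = f ` {x, y}" unfolding ed by auto
      then have "e \<subseteq> verts H" using assms(2) unfolding simple_graph_def by blast
      then have "e = {x, y}" using inj_on_image_eq_iff[OF inj, of e "{x, y}"] e(2) xy by blast
      then show False using e xy by simp
    qed
  qed
qed

lemma avoids_if_proper:
  assumes "simple_graph H" "edges H \<noteq> {}" "\<And>x y. norm (x - y) = 1 \<Longrightarrow> c x \<noteq> c y"
  shows "avoids ind H c"
proof -
  obtain x y where e: "x \<in> verts H" "y \<in> verts H" "{x, y} \<in> edges H"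
    using assms(1,2) unfolding simple_graph_def by blast
  show ?thesis unfolding avoids_def
  proof clarify
    fix g assume g: "unit_embedding ind H g" "monochromatic c (g ` verts H)"
    then have "norm (g x - g y) = 1" using e by (auto simp: unit_embedding_def)
    moreover have "c (g x) = c (g y)" using g(2) e by (auto simp: monochromatic_def)
    ultimately show False using assms(3) by blast
  qed
qed

lemma zero_density_avoidable_iff:
  fixes H :: "'v graph"
  assumes dim: "2 \<le> DIM('a::euclidean_space)" and H: "simple_graph H" "edges H \<noteq> {}"
    and dens: "(\<lambda>N. real (Max {card (edges G) | G. subgraph G (hypercube N) \<and> \<not> cube_contains ind G H}) /
      real (card (edges (hypercube N)))) \<longlonglongrightarrow> 0"
  shows "(\<exists>c :: 'a \<Rightarrow> nat. c \<in> UNIV \<rightarrow> {..<r} \<and> avoids ind H c) \<longleftrightarrow>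
    (\<exists>c :: 'a \<Rightarrow> nat. c \<in> UNIV \<rightarrow> {..<r} \<and> (\<forall>x\<in>UNIV. \<forall>y\<in>UNIV. norm (x - y) = 1 \<longrightarrow> c x \<noteq> c y))"
proof
  assume "\<exists>c :: 'a \<Rightarrow> nat. c \<in> UNIV \<rightarrow> {..<r} \<and> (\<forall>x\<in>UNIV. \<forall>y\<in>UNIV. norm (x - y) = 1 \<longrightarrow> c x \<noteq> c y)"
  then show "\<exists>c :: 'a \<Rightarrow> nat. c \<in> UNIV \<rightarrow> {..<r} \<and> avoids ind H c"
    using avoids_if_proper[OF H] by blast
next
  assume "\<exists>c :: 'a \<Rightarrow> nat. c \<in> UNIV \<rightarrow> {..<r} \<and> avoids ind H c"
  then obtain c :: "'a \<Rightarrow> nat" where c: "c \<in> UNIV \<rightarrow> {..<r}" "avoids ind H c" by blast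
  show "\<exists>c :: 'a \<Rightarrow> nat. c \<in> UNIV \<rightarrow> {..<r} \<and> (\<forall>x\<in>UNIV. \<forall>y\<in>UNIV. norm (x - y) = 1 \<longrightarrow> c x \<noteq> c y)"
  proof (rule ccontr)
    assume "\<not> ?thesis"
    then have bad: "\<exists>x y. norm (x - y) = 1 \<and> c' x = c' y" if "c' \<in> UNIV \<rightarrow> {..<r}" for c' :: "'a \<Rightarrow> nat"
      using that by blast
    obtain K where K: "0 < K" and cube: "\<And>N. \<exists>(\<theta> :: (nat \<Rightarrow> nat) \<Rightarrow> 'a) i. inj_on \<theta> (cube_verts N) \<and>
      (\<forall>x\<in>cube_verts N. \<forall>y\<in>cube_verts N. {x, y} \<in> edges (hypercube N) \<longleftrightarrow> norm (\<theta> x - \<theta> y) = 1) \<and>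
      card (edges (hypercube N)) \<le> K * card {e \<in> edges (hypercube N). \<forall>x\<in>e. c (\<theta> x) = i}"
      using dense_monochromatic_subcube[OF dim c(1) bad] by blast
    obtain N where N: "\<And>G. subgraph G (hypercube N) \<Longrightarrow>
        card (edges (hypercube N)) \<le> K * card (edges G) \<Longrightarrow> cube_contains ind G H"
      using exists_cube_above_extremal_number[OF dens K] by blast
    obtain \<theta> :: "(nat \<Rightarrow> nat) \<Rightarrow> 'a" and i where \<theta>: "inj_on \<theta> (cube_verts N)"
      and iff: "\<And>x y. x \<in> cube_verts N \<Longrightarrow> y \<in> cube_verts N \<Longrightarrow>
         {x, y} \<in> edges (hypercube N) \<longleftrightarrow> norm (\<theta> x - \<theta> y) = 1"
      and card: "card (edges (hypercube N)) \<le> K * card {e \<in> edges (hypercube N). \<forall>x\<in>e. c (\<theta> x) = i}"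
      using cube[of N] by blast
    \<comment> \<open>The subgraph of the cube induced by the colour class. Thus a nonedge of
      \<open>G\<close> is a nonedge of the cube and has length other than 1, and isolated vertices
      of \<open>H\<close> receive the colour \<open>i\<close> too.\<close>
    define G where "G = ({x \<in> cube_verts N. c (\<theta> x) = i}, {e \<in> edges (hypercube N). \<forall>x\<in>e. c (\<theta> x) = i})"
    have "subgraph G (hypercube N)" by (auto simp: G_def subgraph_def hypercube_def)
    then have "cube_contains ind G H" using N[of G] card by (simp add: G_def)
    then obtain f :: "'v \<Rightarrow> nat \<Rightarrow> nat" where f: "inj_on f (verts H)" "f ` verts H \<subseteq> verts G"
      "\<And>x y. x \<in> verts H \<Longrightarrow> y \<in> verts H \<Longrightarrow> {x, y} \<in> edges H \<Longrightarrow> {f x, f y} \<in> edges G"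
      "\<And>x y. ind \<Longrightarrow> x \<in> verts H \<Longrightarrow> y \<in> verts H \<Longrightarrow> {x, y} \<notin> edges H \<Longrightarrow> {f x, f y} \<notin> edges G"
      by (rule cube_contains_embedding[OF _ H(1)]) (rule that)
    have fv: "f x \<in> cube_verts N" "c (\<theta> (f x)) = i" if "x \<in> verts H" for x
      using f(2) that by (auto simp: G_def)
    have "unit_embedding ind H (\<theta> \<circ> f)"
      unfolding unit_embedding_def
    proof (intro conjI ballI impI)
      show "inj_on (\<theta> \<circ> f) (verts H)"
        using f(1) \<theta> fv by (intro comp_inj_on) (auto intro: inj_on_subset)
      show "norm ((\<theta> \<circ> f) x - (\<theta> \<circ> f) y) = 1"
        if "x \<in> verts H" "y \<in> verts H" "{x, y} \<in> edges H" for x y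
        using f(3)[OF that] iff[OF fv(1) fv(1)] that by (simp add: G_def)
      show "norm ((\<theta> \<circ> f) x - (\<theta> \<circ> f) y) \<noteq> 1"
        if "ind" "x \<in> verts H" "y \<in> verts H" "{x, y} \<notin> edges H" for x y
        using f(4)[OF that] iff[OF fv(1) fv(1)] fv(2) that by (simp add: G_def)
    qed
    moreover have "monochromatic c ((\<theta> \<circ> f) ` verts H)" using fv by (auto simp: monochromatic_def)
    ultimately show False using c(2) unfolding avoids_def by blast
  qed
qed

section \<open>Edge replacements\<close>

text \<open>What makes a cube edge good for edge replacement: a copy of \<open>H\<close> of colour
  \<open>i\<close> on the line through the edge, with \<open>u\<close> at the end \<open>x\<close>
  and \<open>v\<close> at the end \<open>y\<close>. Its other vertices may lie anywhere on the line,
  usually outside the cube.\<close>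

definition line_copy ::
  "'v graph \<Rightarrow> 'v \<Rightarrow> 'v \<Rightarrow> 'a::real_normed_vector set \<Rightarrow> ((nat \<Rightarrow> 'a) \<Rightarrow> nat) \<Rightarrow>
    nat \<Rightarrow> nat \<Rightarrow> (nat \<Rightarrow> 'a) \<Rightarrow> (nat \<Rightarrow> 'a) \<Rightarrow> bool" where
  "line_copy H u v X \<kappa> i j x y \<longleftrightarrow> (\<exists>g. unit_embedding False H g \<and> g ` verts H \<subseteq> X \<and>
     g u = x j \<and> g v = y j \<and> (\<forall>w\<in>verts H. \<kappa> (x(j := g w)) = i))"

lemma dense_line_copy_subcube:
  fixes c :: "'a::euclidean_space \<Rightarrow> nat" and H :: "'v graph"
  assumes dim: "2 \<le> DIM('a)" and c: "c \<in> UNIV \<rightarrow> {..<r}" and fin: "finite (verts H)"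
    and uv: "u \<in> verts H" "v \<in> verts H" "u \<noteq> v"
    and bad: "\<And>c' :: 'a \<Rightarrow> nat. c' \<in> UNIV \<rightarrow> {..<r} \<Longrightarrow> \<not> avoids False H c'"
  obtains K and X :: "'a set" where "0 < K" and "\<And>N. \<exists>\<phi> s i. generic_grid_map N X \<phi> \<and>
      s \<in> grid N (X \<times> X) \<and> (\<forall>j<N. fst (s j) \<noteq> snd (s j)) \<and>
      card (edges (hypercube N)) \<le> K * card {(j, \<epsilon>) \<in> up_edges N.
        line_copy H u v X (\<lambda>x. c (\<phi> x)) i j (subcube N s (\<epsilon>(j := 1))) (subcube N s \<epsilon>)}"
proof -
  have r: "0 < r" using c by fastforce
  obtain X :: "'a set" where X: "finite X"
    "\<And>c. c \<in> X \<rightarrow> {..<r} \<Longrightarrow>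
       \<exists>g i. unit_embedding False H g \<and> g ` verts H \<subseteq> X \<and> (\<forall>w\<in>verts H. c (g w) = i)"
    using finite_unavoidable_set[OF fin r bad] by blast
  \<comment> \<open>The vertices \<open>u\<close> and \<open>v\<close> need not be adjacent, so
    their distance is not prescribed. Distinctness keeps the subcube nondegenerate.\<close>
  define P where "P = {(p, q) \<in> X \<times> X. p \<noteq> q}"
  have P: "finite P" "P \<subseteq> X \<times> X"
    using X(1) by (auto simp: P_def intro: finite_subset[of _ "X \<times> X"])
  have pair: "\<exists>g. unit_embedding False H g \<and> g ` verts H \<subseteq> X \<and> (\<forall>w\<in>verts H. c' (g w) = c' (g u)) \<and>
      (g u, g v) \<in> P" if c': "c' \<in> X \<rightarrow> {..<r}" for c' :: "'a \<Rightarrow> nat"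
  proof -
    obtain g i where g: "unit_embedding False H g" "g ` verts H \<subseteq> X" "\<forall>w\<in>verts H. c' (g w) = i"
      using X(2)[OF c'] by blast
    have "g u \<noteq> g v" using g(1) uv by (auto simp: unit_embedding_def inj_on_def)
    then have "(g u, g v) \<in> P" using g(2) uv by (auto simp: P_def)
    then show ?thesis using g uv by auto
  qed
  have "P \<noteq> {}" using pair[of "\<lambda>_. 0"] r by auto
  show thesis
  proof (rule that[of "card P * r" X])
    show "0 < card P * r" using P \<open>P \<noteq> {}\<close> r by (simp add: card_gt_0_iff)
    fix N
    obtain \<phi> where \<phi>: "generic_grid_map N X \<phi>" using exists_generic_grid_map[OF dim X(1)] by blast
    have "\<exists>p q i. (p, q) \<in> P \<and> i < r \<and>
        line_copy H u v X (\<lambda>x. c (\<phi> x)) i j (z(j := p)) (z(j := q))" if "j < N" "z \<in> grid N X" for j z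
    proof -
      obtain g where g: "unit_embedding False H g" "g ` verts H \<subseteq> X"
        "\<forall>w\<in>verts H. c (\<phi> (z(j := g w))) = c (\<phi> (z(j := g u)))" "(g u, g v) \<in> P"
        using pair[of "\<lambda>p. c (\<phi> (z(j := p)))"] c by auto
      have "c (\<phi> (z(j := g u))) < r" using c by auto
      moreover have "line_copy H u v X (\<lambda>x. c (\<phi> x)) (c (\<phi> (z(j := g u)))) j (z(j := g u)) (z(j := g v))"
        unfolding line_copy_def using g by (intro exI[of _ g]) auto
      ultimately show ?thesis using g(4) by blast
    qed
    then obtain s i where s: "s \<in> grid N P"
      and card: "card (up_edges N) \<le> card P * r * card {(j, \<epsilon>) \<in> up_edges N.
         line_copy H u v X (\<lambda>x. c (\<phi> x)) i j (subcube N s (\<epsilon>(j := 1))) (subcube N s \<epsilon>)}"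
      by (rule exists_dense_subcube[OF P(1) \<open>P \<noteq> {}\<close> P(2) r,
            where Good = "line_copy H u v X (\<lambda>x. c (\<phi> x))"])
    have "s j \<in> P" if "j < N" for j using s that by (auto simp: grid_def)
    then have "\<forall>j<N. fst (s j) \<noteq> snd (s j)" by (fastforce simp: P_def)
    moreover have "s \<in> grid N (X \<times> X)" using s P(2) unfolding grid_def by auto
    ultimately show "\<exists>\<phi> s i. generic_grid_map N X \<phi> \<and>
      s \<in> grid N (X \<times> X) \<and> (\<forall>j<N. fst (s j) \<noteq> snd (s j)) \<and>
      card (edges (hypercube N)) \<le> card P * r * card {(j, \<epsilon>) \<in> up_edges N.
        line_copy H u v X (\<lambda>x. c (\<phi> x)) i j (subcube N s (\<epsilon>(j := 1))) (subcube N s \<epsilon>)}"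
      using \<phi> card unfolding card_edges_hypercube by blast
  qed
qed

lemma card_ones_upd:
  fixes \<epsilon> :: "nat \<Rightarrow> nat"
  assumes "j < N" "\<epsilon> j = 0"
  shows "card {i. i < N \<and> (\<epsilon>(j := 1)) i = 1} = Suc (card {i. i < N \<and> \<epsilon> i = 1})"
proof -
  have "{i. i < N \<and> (\<epsilon>(j := 1)) i = 1} = insert j {i. i < N \<and> \<epsilon> i = 1}" using assms by auto
  moreover have "finite {i. i < N \<and> \<epsilon> i = 1}" by simp
  ultimately show ?thesis using assms card_insert_disjoint[of "{i. i < N \<and> \<epsilon> i = 1}" j] by auto
qed

text \<open>Each edge of the layered copy of \<Gamma> lies on a grid line carrying a copy of
  \<open>H\<close> through its two ends, and these copies are glued. Lengths of edges are right
  because every edge stays on one line; the work lies in showing that copies on different lines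
  share no private vertices.\<close>

lemma edge_replacement_embedding:
  fixes H :: "'v graph" and \<Gamma> :: "'g graph" and c :: "'a::euclidean_space \<Rightarrow> nat"
  assumes H: "simple_graph H" and uv: "u \<in> verts H" "v \<in> verts H" "u \<noteq> v"
    and bip: "bipartite_with_parts \<Gamma> A B"
    and \<phi>: "generic_grid_map N X \<phi>" and s: "s \<in> grid N (X \<times> X)"
    and sne: "\<And>j. j < N \<Longrightarrow> fst (s j) \<noteq> snd (s j)"
    and copy: "contains_layered_copy N ({\<epsilon> \<in> cube_verts N. c (\<phi> (subcube N s \<epsilon>)) = i},
        up_edge ` {(j, \<epsilon>) \<in> up_edges N.
          line_copy H u v X (\<lambda>x. c (\<phi> x)) i j (subcube N s (\<epsilon>(j := 1))) (subcube N s \<epsilon>)}) \<Gamma> A B"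
  shows "\<not> avoids False (edge_replacement \<Gamma> A B H u v) c"
proof -
  define P where "P = {(a, b). a \<in> A \<and> b \<in> B \<and> {a, b} \<in> edges \<Gamma>}"
  define F where "F = edge_replacement \<Gamma> A B H u v"
  let ?good = "{(j, \<epsilon>) \<in> up_edges N.
          line_copy H u v X (\<lambda>x. c (\<phi> x)) i j (subcube N s (\<epsilon>(j := 1))) (subcube N s \<epsilon>)}"
  have AB: "A \<union> B = verts \<Gamma>" using bip by (simp add: bipartite_with_parts_def)
  obtain f k where f: "inj_on f (verts \<Gamma>)"
    and fv: "\<And>x. x \<in> verts \<Gamma> \<Longrightarrow> f x \<in> cube_verts N \<and> c (\<phi> (subcube N s (f x))) = i"
    and fe: "\<And>e. e \<in> edges \<Gamma> \<Longrightarrow> f ` e \<in> up_edge ` ?good"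
    and k: "1 \<le> k" and fA: "f ` A \<subseteq> layer N k" and fB: "f ` B \<subseteq> layer N (k - 1)"
  proof -
    from copy obtain K f k where K: "subgraph K ({\<epsilon> \<in> cube_verts N. c (\<phi> (subcube N s \<epsilon>)) = i}, up_edge ` ?good)"
      and iso: "graph_iso f \<Gamma> K"
      and k: "1 \<le> k" and fA: "f ` A \<subseteq> layer N k" and fB: "f ` B \<subseteq> layer N (k - 1)"
      unfolding contains_layered_copy_def by blast
    have inj: "inj_on f (verts \<Gamma>)" and im: "f ` verts \<Gamma> = verts K" and ed: "edges K = (\<lambda>e. f ` e) ` edges \<Gamma>"
      using iso by (auto simp: graph_iso_def bij_betw_def)
    have 1: "verts K \<subseteq> {\<epsilon> \<in> cube_verts N. c (\<phi> (subcube N s \<epsilon>)) = i}" and 2: "edges K \<subseteq> up_edge ` ?good"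
      using K unfolding subgraph_def fst_conv snd_conv by blast+
    show thesis
    proof (rule that[OF inj _ _ k fA fB])
      show "f x \<in> cube_verts N \<and> c (\<phi> (subcube N s (f x))) = i" if "x \<in> verts \<Gamma>" for x
        using 1 im that by blast
      show "f ` e \<in> up_edge ` ?good" if "e \<in> edges \<Gamma>" for e
        using 2 ed that by blast
    qed
  qed
  have sub: "subcube N s \<epsilon> \<in> grid N X" for \<epsilon> by (rule subcube_in_grid[OF s order_refl])
  have "\<exists>j g. j < N \<and> f b j = 0 \<and> f a = (f b)(j := 1) \<and> unit_embedding False H g \<and> g ` verts H \<subseteq> X \<and>
      g u = fst (s j) \<and> g v = snd (s j) \<and> (\<forall>w\<in>verts H. c (\<phi> ((subcube N s (f b))(j := g w))) = i)"
    if ab: "(a, b) \<in> P" for a b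
  proof -
    have "{f a, f b} \<in> up_edge ` ?good" using fe[of "{a, b}"] ab by (simp add: P_def)
    then obtain j \<epsilon> where e: "{f a, f b} = {\<epsilon>, \<epsilon>(j := 1)}" "(j, \<epsilon>) \<in> up_edges N"
      and lc: "line_copy H u v X (\<lambda>x. c (\<phi> x)) i j (subcube N s (\<epsilon>(j := 1))) (subcube N s \<epsilon>)"
      by (auto simp: up_edge_def)
    have j: "j < N" "\<epsilon> j = 0" using e(2) by (auto simp: up_edges_def)
    \<comment> \<open>Counting ones orients the cube edge: the image of \<open>a\<close> is the
      upper end, where the copy has \<open>u\<close>, and the image of \<open>b\<close> the lower
      end, where it has \<open>v\<close>.\<close>
    have "card {i. i < N \<and> f a i = 1} = k" "card {i. i < N \<and> f b i = 1} = k - 1"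
      using fA fB ab by (auto simp: P_def layer_def)
    then have "f b \<noteq> \<epsilon>(j := 1)" if "f a = \<epsilon>" using that card_ones_upd[of j N \<epsilon>, OF j] k by auto
    then have fab: "f b = \<epsilon>" "f a = \<epsilon>(j := 1)" using e(1) by (auto simp: doubleton_eq_iff)
    have sc: "subcube N s (\<epsilon>(j := 1)) = (subcube N s \<epsilon>)(j := fst (s j))" "subcube N s \<epsilon> j = snd (s j)"
      using subcube_upd[OF j(1), of s \<epsilon> 1] j by (simp_all add: subcube_def)
    show ?thesis using lc j unfolding line_copy_def sc fab by auto
  qed
  then obtain J g where Jg: "\<And>a b. (a, b) \<in> P \<Longrightarrow> J a b < N \<and> f b (J a b) = 0 \<and>
      f a = (f b)(J a b := 1) \<and> unit_embedding False H (g a b) \<and> g a b ` verts H \<subseteq> X \<and>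
      g a b u = fst (s (J a b)) \<and> g a b v = snd (s (J a b)) \<and>
      (\<forall>w\<in>verts H. c (\<phi> ((subcube N s (f b))(J a b := g a b w))) = i)"
    by metis
  define t where "t = case_sum (\<lambda>\<gamma>. subcube N s (f \<gamma>))
      (\<lambda>((a, b), w). (subcube N s (f b))(J a b := g a b w))"
  \<comment> \<open>At \<open>u\<close> and \<open>v\<close> the copy on the line passes through the
    cube vertices belonging to \<open>a\<close> and \<open>b\<close>, so the definitions on the two
    summands are compatible.\<close>
  have t_role: "t (role u v a b w) = (subcube N s (f b))(J a b := g a b w)" if "(a, b) \<in> P" for a b w
  proof -
    have "subcube N s (f a) = (subcube N s (f b))(J a b := g a b u)"
      using subcube_upd[of "J a b" N s "f b" 1] Jg[OF that] by simp
    moreover have "subcube N s (f b) = (subcube N s (f b))(J a b := g a b v)"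
      using Jg[OF that] by (intro fun_upd_idem[symmetric]) (simp add: subcube_def)
    ultimately show ?thesis by (auto simp: role_def t_def)
  qed
  have vF: "verts F = Inl ` verts \<Gamma> \<union> (\<Union>(a, b)\<in>P. role u v a b ` verts H)"
    and eF: "edges F = (\<Union>(a, b)\<in>P. (\<lambda>e. role u v a b ` e) ` edges H)"
    by (simp_all add: F_def edge_replacement_def P_def Let_def)
  have vF': "(\<exists>\<gamma>. x = Inl \<gamma> \<and> \<gamma> \<in> verts \<Gamma>) \<or>
      (\<exists>a b w. x = Inr ((a, b), w) \<and> (a, b) \<in> P \<and> w \<in> verts H \<and> w \<noteq> u \<and> w \<noteq> v)" if "x \<in> verts F" for x
    using that AB unfolding vF by (auto simp: role_def P_def split: if_splits)
  have t_col: "t x \<in> grid N X \<and> c (\<phi> (t x)) = i" if x: "x \<in> verts F" for x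
    using vF'[OF x]
  proof (elim disjE exE conjE)
    fix \<gamma> assume "x = Inl \<gamma>" "\<gamma> \<in> verts \<Gamma>"
    then show ?thesis using fv sub by (simp add: t_def)
  next
    fix a b w assume "x = Inr ((a, b), w)" "(a, b) \<in> P" "w \<in> verts H"
    then show ?thesis using Jg[of a b] sub by (auto simp: t_def intro!: grid_upd)
  qed
  \<comment> \<open>The coordinates in which a grid point leaves the subcube. There are none for
    vertices of \<Gamma>, and for a private vertex exactly the direction of its line, because the
    copy is injective and \<open>w\<close> differs from \<open>u\<close> and \<open>v\<close>. This
    separates old from new vertices.\<close>
  define off where "off x = {j. j < N \<and> x j \<noteq> fst (s j) \<and> x j \<noteq> snd (s j)}" for x
  have off_cube: "off (subcube N s \<epsilon>) = {}" for \<epsilon> by (auto simp: off_def subcube_def)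
  have off_new: "off ((subcube N s (f b))(J a b := g a b w)) = {J a b}"
    if "(a, b) \<in> P" "w \<in> verts H" "w \<noteq> u" "w \<noteq> v" for a b w
  proof -
    have "g a b w \<noteq> g a b u" "g a b w \<noteq> g a b v"
      using Jg[OF that(1)] that uv unfolding unit_embedding_def inj_on_def by blast+
    then show ?thesis using Jg[OF that(1)] by (auto simp: off_def subcube_def)
  qed
  have inj_sub: "inj_on (subcube N s) (cube_verts N)" by (rule inj_on_subcube[OF sne])
  \<comment> \<open>Equal points leave the cube in the same direction. Away from it they agree, and
    in it both lower ends have bit 0, so the lower ends coincide; the direction then determines the
    upper end, and injectivity of the copy determines \<open>w\<close>.\<close>
  have new_eq: "a = a' \<and> b = b' \<and> w = w'"
    if P: "(a, b) \<in> P" "(a', b') \<in> P" and w: "w \<in> verts H" "w \<noteq> u" "w \<noteq> v" "w' \<in> verts H" "w' \<noteq> u" "w' \<noteq> v"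
      and eq: "(subcube N s (f b))(J a b := g a b w) = (subcube N s (f b'))(J a' b' := g a' b' w')"
    for a b w a' b' w'
  proof -
    have J: "J a b = J a' b'" using off_new[OF P(1) w(1-3)] off_new[OF P(2) w(4-6)] eq by auto
    have verts: "a \<in> verts \<Gamma>" "b \<in> verts \<Gamma>" "a' \<in> verts \<Gamma>" "b' \<in> verts \<Gamma>" using P AB by (auto simp: P_def)
    have "subcube N s (f b) m = subcube N s (f b') m" for m
    proof (cases "m = J a b")
      case True
      then show ?thesis using Jg[OF P(1)] Jg[OF P(2)] J by (simp add: subcube_def)
    next
      case False
      then show ?thesis using fun_cong[OF eq, of m] J by simp
    qed
    then have "f b = f b'" using inj_sub fv verts by (meson ext inj_onD)
    then have b: "b = b'" using f verts by (meson inj_onD)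
    have "f a = f a'" using Jg[OF P(1)] Jg[OF P(2)] \<open>f b = f b'\<close> J by simp
    then have a: "a = a'" using f verts by (meson inj_onD)
    have "g a b w = g a b w'" using fun_cong[OF eq, of "J a b"] a b by simp
    then have "w = w'" using Jg[OF P(1)] w unfolding unit_embedding_def inj_on_def by blast
    then show ?thesis using a b by blast
  qed
  have "inj_on t (verts F)"
  proof (rule inj_onI)
    fix x y assume xy: "x \<in> verts F" "y \<in> verts F" "t x = t y"
    consider (ll) \<gamma> \<gamma>' where "x = Inl \<gamma>" "\<gamma> \<in> verts \<Gamma>" "y = Inl \<gamma>'" "\<gamma>' \<in> verts \<Gamma>"
      | (lr) \<gamma> a b w where "x = Inl \<gamma>" "y = Inr ((a, b), w)" "(a, b) \<in> P" "w \<in> verts H" "w \<noteq> u" "w \<noteq> v"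
      | (rl) \<gamma> a b w where "y = Inl \<gamma>" "x = Inr ((a, b), w)" "(a, b) \<in> P" "w \<in> verts H" "w \<noteq> u" "w \<noteq> v"
      | (rr) a b w a' b' w' where "x = Inr ((a, b), w)" "(a, b) \<in> P" "w \<in> verts H" "w \<noteq> u" "w \<noteq> v"
          "y = Inr ((a', b'), w')" "(a', b') \<in> P" "w' \<in> verts H" "w' \<noteq> u" "w' \<noteq> v"
      using vF'[OF xy(1)] vF'[OF xy(2)] by blast
    then show "x = y"
    proof cases
      case ll
      then have "subcube N s (f \<gamma>) = subcube N s (f \<gamma>')" using xy by (simp add: t_def)
      then have "f \<gamma> = f \<gamma>'" using inj_sub fv ll by (meson inj_onD)
      then have "\<gamma> = \<gamma>'" using f ll by (meson inj_onD)
      then show ?thesis using ll by simp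
    next
      case lr
      then have "off (t x) = {}" "off (t y) = {J a b}" using off_cube off_new by (auto simp: t_def)
      then show ?thesis using xy by simp
    next
      case rl
      then have "off (t y) = {}" "off (t x) = {J a b}" using off_cube off_new by (auto simp: t_def)
      then show ?thesis using xy by simp
    next
      case rr
      then show ?thesis using new_eq[of a b a' b' w w'] xy(3) by (simp add: t_def)
    qed
  qed
  then have inj: "inj_on (\<phi> \<circ> t) (verts F)"
    using \<phi> t_col by (intro comp_inj_on) (auto simp: generic_grid_map_def intro: inj_on_subset)
  have "norm ((\<phi> \<circ> t) x - (\<phi> \<circ> t) y) = 1" if xy: "{x, y} \<in> edges F" for x y
  proof -
    obtain a b e where e: "(a, b) \<in> P" "e \<in> edges H" "{x, y} = role u v a b ` e"
      using xy unfolding eF by auto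
    obtain p q where pq: "e = {p, q}" "p \<in> verts H" "q \<in> verts H"
      using H e(2) unfolding simple_graph_def by blast
    have *: "norm (\<phi> (t (role u v a b p)) - \<phi> (t (role u v a b q))) = 1"
    proof -
      have "norm (\<phi> (t (role u v a b p)) - \<phi> (t (role u v a b q))) = norm (g a b p - g a b q)"
        using \<phi> Jg[OF e(1)] unfolding t_role[OF e(1)] generic_grid_map_def by blast
      also have "\<dots> = 1" using Jg[OF e(1)] e(2) pq unfolding unit_embedding_def by blast
      finally show ?thesis .
    qed
    have "{x, y} = {role u v a b p, role u v a b q}" using e(3) pq by simp
    then show ?thesis using * by (auto simp: doubleton_eq_iff norm_minus_commute)
  qed
  then have "unit_embedding False F (\<phi> \<circ> t)" using inj by (simp add: unit_embedding_def)
  moreover have "monochromatic c ((\<phi> \<circ> t) ` verts F)" using t_col by (auto simp: monochromatic_def)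
  ultimately show ?thesis unfolding avoids_def F_def by blast
qed

lemma avoids_edge_replacement:
  assumes H: "simple_graph H" and uv: "u \<noteq> v"
    and \<Gamma>: "edges \<Gamma> \<noteq> {}" "bipartite_with_parts \<Gamma> A B" and "avoids False H c"
  shows "avoids False (edge_replacement \<Gamma> A B H u v) c"
proof -
  define F where "F = edge_replacement \<Gamma> A B H u v"
  obtain e where "e \<in> edges \<Gamma>" using \<Gamma>(1) by blast
  then obtain a b where ab: "a \<in> A" "b \<in> B" "{a, b} \<in> edges \<Gamma>"
    using \<Gamma>(2) unfolding bipartite_with_parts_def by metis
  then have "a \<noteq> b" using \<Gamma>(2) unfolding bipartite_with_parts_def by blast
  have vF: "role u v a b w \<in> verts F" if "w \<in> verts H" for w
    using ab that by (auto simp: F_def edge_replacement_def Let_def)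
  have eF: "role u v a b ` e \<in> edges F" if "e \<in> edges H" for e
    using ab that by (auto simp: F_def edge_replacement_def Let_def)
  have inj: "inj_on (role u v a b) (verts H)"
    using uv \<open>a \<noteq> b\<close> by (auto simp: inj_on_def role_def)
  have "avoids False F c" unfolding avoids_def
  proof clarify
    fix g assume g: "unit_embedding False F g" "monochromatic c (g ` verts F)"
    have "inj_on (g \<circ> role u v a b) (verts H)"
      using inj g(1) vF by (intro comp_inj_on) (auto simp: unit_embedding_def intro: inj_on_subset)
    moreover have "norm ((g \<circ> role u v a b) x - (g \<circ> role u v a b) y) = 1"
      if "x \<in> verts H" "y \<in> verts H" "{x, y} \<in> edges H" for x y
      using g(1) vF[OF that(1)] vF[OF that(2)] eF[OF that(3)] by (simp add: unit_embedding_def)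
    ultimately have "unit_embedding False H (g \<circ> role u v a b)" by (simp add: unit_embedding_def)
    moreover have "monochromatic c ((g \<circ> role u v a b) ` verts H)"
      using g(2) vF unfolding monochromatic_def by auto
    ultimately show False using assms(5) unfolding avoids_def by blast
  qed
  then show ?thesis by (simp add: F_def)
qed

lemma edge_replacement_avoidable_iff:
  fixes H :: "'v graph" and \<Gamma> :: "'g graph"
  assumes dim: "2 \<le> DIM('a::euclidean_space)" and H: "simple_graph H"
    and uv: "u \<in> verts H" "v \<in> verts H" "u \<noteq> v"
    and \<Gamma>: "edges \<Gamma> \<noteq> {}" "bipartite_with_parts \<Gamma> A B" "zero_strong_cube_density \<Gamma> A B"
  shows "(\<exists>c :: 'a \<Rightarrow> nat. c \<in> UNIV \<rightarrow> {..<r} \<and> avoids False (edge_replacement \<Gamma> A B H u v) c) \<longleftrightarrow>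
    (\<exists>c :: 'a \<Rightarrow> nat. c \<in> UNIV \<rightarrow> {..<r} \<and> avoids False H c)"
proof
  assume "\<exists>c :: 'a \<Rightarrow> nat. c \<in> UNIV \<rightarrow> {..<r} \<and> avoids False H c"
  then show "\<exists>c :: 'a \<Rightarrow> nat. c \<in> UNIV \<rightarrow> {..<r} \<and> avoids False (edge_replacement \<Gamma> A B H u v) c"
    using avoids_edge_replacement[OF H uv(3) \<Gamma>(1,2)] by blast
next
  assume "\<exists>c :: 'a \<Rightarrow> nat. c \<in> UNIV \<rightarrow> {..<r} \<and> avoids False (edge_replacement \<Gamma> A B H u v) c"
  then obtain c :: "'a \<Rightarrow> nat" where c: "c \<in> UNIV \<rightarrow> {..<r}" "avoids False (edge_replacement \<Gamma> A B H u v) c"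
    by blast
  show "\<exists>c :: 'a \<Rightarrow> nat. c \<in> UNIV \<rightarrow> {..<r} \<and> avoids False H c"
  proof (rule ccontr)
    assume "\<not> ?thesis"
    then have bad: "\<not> avoids False H c'" if "c' \<in> UNIV \<rightarrow> {..<r}" for c' :: "'a \<Rightarrow> nat" using that by blast
    have fin: "finite (verts H)" using H by (simp add: simple_graph_def)
    obtain K and X :: "'a set" where K: "0 < K" and cube: "\<And>N. \<exists>\<phi> s i. generic_grid_map N X \<phi> \<and>
      s \<in> grid N (X \<times> X) \<and> (\<forall>j<N. fst (s j) \<noteq> snd (s j)) \<and>
      card (edges (hypercube N)) \<le> K * card {(j, \<epsilon>) \<in> up_edges N.
        line_copy H u v X (\<lambda>x. c (\<phi> x)) i j (subcube N s (\<epsilon>(j := 1))) (subcube N s \<epsilon>)}"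
      using dense_line_copy_subcube[OF dim c(1) fin uv bad] by blast
    have "(\<lambda>N. real (cube_ex_strong N \<Gamma> A B) / real (card (edges (hypercube N)))) \<longlonglongrightarrow> 0"
      using \<Gamma>(3) unfolding zero_strong_cube_density_def by (rule smalloD_tendsto)
    then obtain N where N: "\<And>G. subgraph G (hypercube N) \<Longrightarrow>
        card (edges (hypercube N)) \<le> K * card (edges G) \<Longrightarrow> contains_layered_copy N G \<Gamma> A B"
      unfolding cube_ex_strong_def
      using exists_cube_above_extremal_number[where Q = "\<lambda>N G. contains_layered_copy N G \<Gamma> A B"] K by blast
    obtain \<phi> s i where \<phi>: "generic_grid_map N X \<phi>" and s: "s \<in> grid N (X \<times> X)"
      and sne: "\<And>j. j < N \<Longrightarrow> fst (s j) \<noteq> snd (s j)"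
      and card: "card (edges (hypercube N)) \<le> K * card {(j, \<epsilon>) \<in> up_edges N.
        line_copy H u v X (\<lambda>x. c (\<phi> x)) i j (subcube N s (\<epsilon>(j := 1))) (subcube N s \<epsilon>)}"
      using cube[of N] by blast
    define E where "E = {(j, \<epsilon>) \<in> up_edges N.
        line_copy H u v X (\<lambda>x. c (\<phi> x)) i j (subcube N s (\<epsilon>(j := 1))) (subcube N s \<epsilon>)}"
    \<comment> \<open>The vertex set is the whole colour class, so isolated vertices of \<Gamma> are
      also placed on points of colour \<open>i\<close>.\<close>
    define G where "G = ({\<epsilon> \<in> cube_verts N. c (\<phi> (subcube N s \<epsilon>)) = i}, up_edge ` E)"
    \<comment> \<open>Both ends of a good edge belong to the monochromatic copy on its line, as the
      places of \<open>u\<close> and \<open>v\<close>.\<close>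
    have E_col: "c (\<phi> (subcube N s \<epsilon>)) = i \<and> c (\<phi> (subcube N s (\<epsilon>(j := 1)))) = i \<and>
        \<epsilon> \<in> cube_verts N \<and> \<epsilon>(j := 1) \<in> cube_verts N" if jE: "(j, \<epsilon>) \<in> E" for j \<epsilon>
    proof -
      have j: "j < N" "\<epsilon> j = 0" "\<epsilon> \<in> cube_verts N" using jE by (auto simp: E_def up_edges_def)
      obtain g where g: "g u = subcube N s (\<epsilon>(j := 1)) j" "g v = subcube N s \<epsilon> j"
        "\<And>w. w \<in> verts H \<Longrightarrow> c (\<phi> ((subcube N s (\<epsilon>(j := 1)))(j := g w))) = i"
        using jE by (auto simp: E_def line_copy_def)
      have "(subcube N s (\<epsilon>(j := 1)))(j := g u) = subcube N s (\<epsilon>(j := 1))" by (simp add: g)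
      moreover have "(subcube N s (\<epsilon>(j := 1)))(j := g v) = subcube N s \<epsilon>"
        using subcube_upd[OF j(1), of s \<epsilon> 1] by (simp add: g)
      ultimately show ?thesis using g(3)[OF uv(1)] g(3)[OF uv(2)] j cube_verts_upd[of \<epsilon> N j 1] by simp
    qed
    have "E \<subseteq> up_edges N" by (auto simp: E_def)
    then have "up_edge ` E \<subseteq> edges (hypercube N)" unfolding up_edge_image[symmetric] by blast
    moreover have "up_edge ` E \<subseteq> Pow {\<epsilon> \<in> cube_verts N. c (\<phi> (subcube N s \<epsilon>)) = i}"
      using E_col by (auto simp: up_edge_def)
    ultimately have sub: "subgraph G (hypercube N)" by (auto simp: G_def subgraph_def hypercube_def)
    have "card (edges G) = card E"
      unfolding G_def snd_conv using \<open>E \<subseteq> up_edges N\<close> by (intro card_image inj_on_subset[OF inj_on_up_edge])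
    then have "contains_layered_copy N G \<Gamma> A B" using N[OF sub] card by (simp add: E_def)
    then have "\<not> avoids False (edge_replacement \<Gamma> A B H u v) c"
      unfolding G_def E_def using edge_replacement_embedding[OF H uv \<Gamma>(2) \<phi> s sne] by blast
    then show False using c(2) by blast
  qed
qed

section \<open>Rich monochromatic sets\<close>

text \<open>Delete a vertex of degree below \<open>d\<close> together with its hyperedges as long as
  there is one. Each deletion loses fewer than \<open>d\<close> hyperedges, so the strict inequality
  survives and keeps the hypergraph nonempty.\<close>

lemma exists_min_degree_subset:
  assumes "finite V" "finite L" "\<And>l. l \<in> L \<Longrightarrow> S l \<subseteq> V \<and> S l \<noteq> {}" "d * card V < card L"
  shows "\<exists>W\<subseteq>V. W \<noteq> {} \<and> (\<forall>w\<in>W. d \<le> card {l\<in>L. w \<in> S l \<and> S l \<subseteq> W})"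
  using assms
proof (induction "card V" arbitrary: V L rule: less_induct)
  case less
  show ?case
  proof (cases "\<forall>w\<in>V. d \<le> card {l\<in>L. w \<in> S l}")
    case True
    have "L \<noteq> {}" using less.prems(4) by auto
    then have "V \<noteq> {}" using less.prems(3) by blast
    moreover have "{l\<in>L. w \<in> S l \<and> S l \<subseteq> V} = {l\<in>L. w \<in> S l}" for w
      using less.prems(3) by blast
    ultimately show ?thesis using True by (intro exI[of _ V]) auto
  next
    case False
    then obtain w where w: "w \<in> V" "card {l\<in>L. w \<in> S l} < d" by (auto simp: not_le)
    define L' where "L' = {l\<in>L. w \<notin> S l}"
    have "card L = card L' + card {l\<in>L. w \<in> S l}"
      using less.prems(2) by (subst card_Un_disjoint[symmetric]) (auto simp: L'_def intro!: arg_cong[where f = card])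
    moreover have V: "card V = Suc (card (V - {w}))" using w less.prems(1) by (metis card.remove)
    ultimately have "d * card (V - {w}) < card L'" using less.prems(4) w(2) by simp
    moreover have "\<And>l. l \<in> L' \<Longrightarrow> S l \<subseteq> V - {w} \<and> S l \<noteq> {}" using less.prems(3) by (auto simp: L'_def)
    moreover have "finite L'" "finite (V - {w})" using less.prems by (auto simp: L'_def)
    ultimately obtain W where W: "W \<subseteq> V - {w}" "W \<noteq> {}"
      "\<forall>x\<in>W. d \<le> card {l\<in>L'. x \<in> S l \<and> S l \<subseteq> W}"
      using less.hyps[of "V - {w}" L'] V by auto
    have "card {l\<in>L'. x \<in> S l \<and> S l \<subseteq> W} \<le> card {l\<in>L. x \<in> S l \<and> S l \<subseteq> W}" for x
      using less.prems(2) by (intro card_mono) (auto simp: L'_def)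
    then have "\<forall>x\<in>W. d \<le> card {l\<in>L. x \<in> S l \<and> S l \<subseteq> W}" using W(3) le_trans by blast
    then show ?thesis using W by blast
  qed
qed

definition clear_of :: "'a::real_normed_vector \<Rightarrow> 'a set \<Rightarrow> bool" where
  "clear_of y P \<longleftrightarrow> (\<forall>p\<in>P. y \<noteq> p \<and> norm (y - p) \<noteq> 1)"

text \<open>Exactly what greedy embedding asks for, with \<open>P\<close> the points used so far: a
  copy through an old point \<open>w\<close> that touches nothing else old, and a fresh starting
  point for a copy disjoint from the earlier ones. Only \<open>w\<close> is exempted from
  \<open>P\<close>, since its neighbours in the copy are at distance 1 from it.\<close>

definition rich :: "bool \<Rightarrow> 'v graph \<Rightarrow> nat \<Rightarrow> 'a::real_normed_vector set \<Rightarrow> bool" where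
  "rich ind H M W \<longleftrightarrow>
     (\<forall>w\<in>W. \<forall>P\<subseteq>W. finite P \<longrightarrow> card P \<le> M \<longrightarrow>
        (\<exists>g. unit_embedding ind H g \<and> w \<in> g ` verts H \<and> g ` verts H \<subseteq> W \<and>
             (\<forall>y\<in>g ` verts H - {w}. clear_of y (P - {w})))) \<and>
     (\<forall>P\<subseteq>W. finite P \<longrightarrow> card P \<le> M \<longrightarrow> (\<exists>w\<in>W. clear_of w P))"

text \<open>The second half of richness comes for free once \<open>H\<close> has two vertices: two steps along
  copies of \<open>H\<close> lead away from \<open>P\<close>.\<close>

lemma rich_if_extendable:
  fixes W :: "'a::real_normed_vector set"
  assumes "W \<noteq> {}" and H: "2 \<le> card (verts H)"
    and ext: "\<And>w P. w \<in> W \<Longrightarrow> P \<subseteq> W \<Longrightarrow> finite P \<Longrightarrow> card P \<le> Suc M \<Longrightarrow>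
        \<exists>g. unit_embedding ind H g \<and> w \<in> g ` verts H \<and> g ` verts H \<subseteq> W \<and>
             (\<forall>y\<in>g ` verts H - {w}. clear_of y (P - {w}))"
  shows "rich ind H M W"
  unfolding rich_def
proof (intro conjI ballI allI impI)
  have step: "\<exists>y\<in>W. y \<noteq> w \<and> clear_of y (P - {w})" if w: "w \<in> W" and P: "P \<subseteq> W" "finite P" "card P \<le> Suc M" for w P
  proof -
    obtain g where g: "unit_embedding ind H g" "g ` verts H \<subseteq> W"
      "\<forall>y\<in>g ` verts H - {w}. clear_of y (P - {w})"
      using ext[OF w P] by blast
    have "card (g ` verts H) = card (verts H)" using g(1) by (auto simp: unit_embedding_def card_image)
    then have "\<not> g ` verts H \<subseteq> {w}" using H card_mono[of "{w}" "g ` verts H"] by auto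
    then show ?thesis using g by blast
  qed
  fix P assume P: "P \<subseteq> W" "finite P" "card P \<le> M"
  obtain w where w: "w \<in> W" using assms by blast
  obtain y where y: "y \<in> W" "y \<noteq> w" "clear_of y (P - {w})" using step[OF w P(1,2)] P by auto
  have "y \<notin> P" using y by (auto simp: clear_of_def)
  \<comment> \<open>The point \<open>y\<close> may still be at distance 1 from \<open>w\<close>, and
    \<open>w\<close> may lie in \<open>P\<close>. Hence the second step has to avoid
    \<open>w\<close> as well, which explains the extra one in \<open>Suc M\<close>.\<close>
  have "card (insert w P) \<le> Suc M" using P by (simp add: card_insert_if)
  then obtain x where x: "x \<in> W" "x \<noteq> y" "clear_of x (insert w P - {y})"
    using step[OF y(1), of "insert w P"] P w by auto
  have "clear_of x P" using x(3) \<open>y \<notin> P\<close> by (auto simp: clear_of_def)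
  then show "\<exists>w\<in>W. clear_of w P" using x by blast
next
  fix w P assume "w \<in> W" "P \<subseteq> W" "finite P" "card P \<le> M"
  then show "\<exists>g. unit_embedding ind H g \<and> w \<in> g ` verts H \<and> g ` verts H \<subseteq> W \<and>
             (\<forall>y\<in>g ` verts H - {w}. clear_of y (P - {w}))" using ext by simp
qed

text \<open>A copy of a single vertex leads nowhere, so the starting points need another source: an
  infinite colour class inside a ball of radius 1/2, where no distance reaches 1.\<close>

lemma exists_rich_singleton:
  fixes c :: "'a::euclidean_space \<Rightarrow> nat"
  assumes c: "c \<in> UNIV \<rightarrow> {..<r}" and H: "simple_graph H" "card (verts H) = 1"
  shows "\<exists>i W. (\<forall>x\<in>W. c x = i) \<and> rich ind H M W"
proof -
  obtain h where h: "verts H = {h}" using H(2) by (auto simp: card_1_singleton_iff)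
  have e: "{h} \<notin> edges H" using H(1) unfolding simple_graph_def by (auto simp: singleton_insert_inj_eq)
  have "infinite (ball (0::'a) (1/2))"
    using uncountable_ball[of "1/2" "0::'a"] countable_finite by auto
  moreover have "finite (c ` ball 0 (1/2))" by (rule finite_subset[of _ "{..<r}"]) (use c in auto)
  ultimately obtain i where i: "infinite {x \<in> ball (0::'a) (1/2). c x = i}"
    using pigeonhole_infinite[of "ball (0::'a) (1/2)" c] by metis
  define W where "W = {x \<in> ball (0::'a) (1/2). c x = i}"
  have "rich ind H M W" unfolding rich_def
  proof (intro conjI ballI allI impI)
    fix w and P :: "'a set" assume "w \<in> W"
    have "unit_embedding ind H (\<lambda>_. w)" using e by (auto simp: unit_embedding_def h)
    then show "\<exists>g. unit_embedding ind H g \<and> w \<in> g ` verts H \<and> g ` verts H \<subseteq> W \<and>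
             (\<forall>y\<in>g ` verts H - {w}. clear_of y (P - {w}))"
      using \<open>w \<in> W\<close> by (intro exI[of _ "\<lambda>_. w"]) (auto simp: h)
  next
    fix P :: "'a set" assume P: "P \<subseteq> W" "finite P" "card P \<le> M"
    then obtain w where w: "w \<in> W - P" using i unfolding W_def
      by (metis (no_types, lifting) Diff_infinite_finite finite.emptyI ex_in_conv)
    have "norm (w - p) \<noteq> 1" if "p \<in> P" for p
    proof -
      have "norm w < 1/2" "norm p < 1/2" using w that P by (auto simp: W_def)
      then show ?thesis using norm_triangle_ineq4[of w p] by linarith
    qed
    then have "clear_of w P" using w by (auto simp: clear_of_def)
    then show "\<exists>w\<in>W. clear_of w P" using w by blast
  qed
  moreover have "\<forall>x\<in>W. c x = i" by (simp add: W_def)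
  ultimately show ?thesis by blast
qed

text \<open>The lines in direction \<open>j\<close>, each described by its remaining coordinates,
  partition the grid into classes of size \<open>card X\<close>.\<close>

lemma card_grid_lines:
  assumes "finite X" "j < N"
  shows "card (({..<N} - {j}) \<rightarrow>\<^sub>E X) * card X = card (grid N X)"
proof -
  have "N = Suc (N - 1)" using assms by simp
  then have "card X ^ (N - 1) * card X = card X ^ N" by (metis power_Suc2)
  then show ?thesis using assms by (simp add: grid_def card_PiE)
qed

lemma exists_rich_set:
  fixes c :: "'a::euclidean_space \<Rightarrow> nat" and H :: "'v graph"
  assumes dim: "2 \<le> DIM('a)" and c: "c \<in> UNIV \<rightarrow> {..<r}" and H: "simple_graph H"
    and bad: "\<And>c' :: 'a \<Rightarrow> nat. c' \<in> UNIV \<rightarrow> {..<r} \<Longrightarrow> \<not> avoids ind H c'"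
  shows "\<exists>i W. (\<forall>x\<in>W. c x = i) \<and> rich ind H M W"
proof (cases "card (verts H) = 1")
  case True
  then show ?thesis using exists_rich_singleton[OF c H] by blast
next
  case False
  have fin: "finite (verts H)" "verts H \<noteq> {}" using H by (auto simp: simple_graph_def)
  then have H2: "2 \<le> card (verts H)" using False by (metis One_nat_def Suc_1 card_0_eq le_SucE not_less_eq_eq nat_le_linear le_zero_eq)
  have r: "0 < r" using c by fastforce
  obtain X :: "'a set" where X: "finite X"
    "\<And>c. c \<in> X \<rightarrow> {..<r} \<Longrightarrow>
       \<exists>g i. unit_embedding ind H g \<and> g ` verts H \<subseteq> X \<and> (\<forall>w\<in>verts H. c (g w) = i)"
    using finite_unavoidable_set[OF fin(1) r bad] by blast
  have "X \<noteq> {}" using X(2)[of "\<lambda>_. 0"] r fin(2) by auto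
  then have X0: "0 < card X" using X(1) by (simp add: card_gt_0_iff)
  \<comment> \<open>Up to \<open>Suc M\<close> points must be avoided and each blocks at most two
    directions; one more direction is then free. The value of \<open>N\<close> in the next line
    makes the most frequent colour have more than \<open>d\<close> lines per grid point.\<close>
  define d where "d = 2 * Suc M + 1"
  define N where "N = Suc (r * d * card X)"
  obtain \<phi> where \<phi>: "generic_grid_map N X \<phi>" using exists_generic_grid_map[OF dim X(1)] by blast
  define L where "L = (SIGMA j:{..<N}. ({..<N} - {j}) \<rightarrow>\<^sub>E X)"
  have finL: "finite L" unfolding L_def using X(1) by (auto intro!: finite_PiE)
  have "\<forall>l\<in>L. \<exists>g i. unit_embedding ind H g \<and> g ` verts H \<subseteq> X \<and>
      (\<forall>w\<in>verts H. c (\<phi> ((snd l)(fst l := g w))) = i)"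
    using X(2)[of "\<lambda>p. c (\<phi> ((snd _)(fst _ := p)))"] c by blast
  then obtain g col where g: "\<And>l. l \<in> L \<Longrightarrow> unit_embedding ind H (g l) \<and> g l ` verts H \<subseteq> X \<and>
      (\<forall>w\<in>verts H. c (\<phi> ((snd l)(fst l := g l w))) = col l)"
    by metis
  have "col l < r" if "l \<in> L" for l
  proof -
    obtain w where "w \<in> verts H" using fin(2) by blast
    then have "col l = c (\<phi> ((snd l)(fst l := g l w)))" using g[OF that] by simp
    then show ?thesis using c by auto
  qed
  then have col: "col ` L \<subseteq> {..<r}" by blast
  have cardL: "card L * card X = N * card (grid N X)"
  proof -
    have "card L = (\<Sum>j<N. card (({..<N} - {j}) \<rightarrow>\<^sub>E X))"
      unfolding L_def using X(1) by (intro card_SigmaI) (auto intro!: finite_PiE)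
    then have "card L * card X = (\<Sum>j<N. card (({..<N} - {j}) \<rightarrow>\<^sub>E X) * card X)"
      by (simp only: sum_distrib_right)
    also have "\<dots> = (\<Sum>j<N. card (grid N X))" using card_grid_lines[OF X(1)] by (intro sum.cong) auto
    finally show ?thesis by simp
  qed
  have V0: "0 < card (grid N X)" using X(1) X0 by (simp add: grid_def card_PiE)
  \<comment> \<open>Pigeonhole: the number of lines is \<open>N / card X\<close> times the number of
    grid points, and they are shared among \<open>r\<close> colours.\<close>
  have "\<exists>i<r. d * card (grid N X) < card {l\<in>L. col l = i}"
  proof (rule ccontr)
    assume "\<not> ?thesis"
    then have le: "card {l\<in>L. col l = i} \<le> d * card (grid N X)" if "i < r" for i
      using that not_le by blast
    have "card L = (\<Sum>i<r. card {l\<in>L. col l = i})"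
      using sum_fun_comp[OF finL _ col, of "\<lambda>_. 1::nat"] by simp
    also have "\<dots> \<le> r * (d * card (grid N X))" using sum_bounded_above[of "{..<r}" _ "d * card (grid N X)"] le by simp
    finally have "card L * card X \<le> r * (d * card (grid N X)) * card X" by simp
    then have "N * card (grid N X) \<le> r * d * card X * card (grid N X)" unfolding cardL by (simp add: ac_simps)
    then show False using V0 unfolding N_def by simp
  qed
  then obtain i where i: "d * card (grid N X) < card {l\<in>L. col l = i}" by blast
  define S where "S l = (\<lambda>w. (snd l)(fst l := g l w)) ` verts H" for l
  have S: "S l \<subseteq> grid N X \<and> S l \<noteq> {}" if "l \<in> L" for l
  proof -
    have l: "fst l < N" "snd l \<in> ({..<N} - {fst l}) \<rightarrow>\<^sub>E X"
      using that unfolding L_def by (cases l; simp)+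
    have "(snd l)(fst l := p) \<in> grid N X" if "p \<in> X" for p
      using l(1) that PiE_fun_upd[OF _ l(2), of p "fst l"] by (simp add: grid_def insert_absorb)
    then show ?thesis using g[OF that] fin(2) by (auto simp: S_def)
  qed
  have "\<exists>W\<subseteq>grid N X. W \<noteq> {} \<and> (\<forall>w\<in>W. d \<le> card {l\<in>{l\<in>L. col l = i}. w \<in> S l \<and> S l \<subseteq> W})"
    using finL S by (intro exists_min_degree_subset[OF finite_grid[OF X(1)] _ _ i]) auto
  then obtain W where W: "W \<subseteq> grid N X" "W \<noteq> {}"
    and deg: "\<And>w. w \<in> W \<Longrightarrow> d \<le> card {l\<in>{l\<in>L. col l = i}. w \<in> S l \<and> S l \<subseteq> W}"
    by blast
  have inj\<phi>: "inj_on \<phi> (grid N X)" using \<phi> by (simp add: generic_grid_map_def)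
  have "rich ind H M (\<phi> ` W)"
  proof (rule rich_if_extendable[OF _ H2])
    show "\<phi> ` W \<noteq> {}" using W by blast
    fix y P assume "y \<in> \<phi> ` W" and P: "P \<subseteq> \<phi> ` W" "finite P" "card P \<le> Suc M"
    then obtain w where w: "w \<in> W" "y = \<phi> w" by blast
    obtain Q where Q: "Q \<subseteq> W" "P = \<phi> ` Q" "finite Q" "card Q = card P"
    proof -
      obtain Q where "Q \<subseteq> W" "P = \<phi> ` Q" "inj_on \<phi> Q" using P(1) by (meson subset_image_inj)
      then show thesis using that[of Q] P(2) by (simp add: finite_image_iff card_image)
    qed
    \<comment> \<open>Moving from \<open>w\<close> in a direction outside \<open>B\<close> never leads onto a common line with another point of \<open>Q\<close>.\<close>
    define B where "B = (\<Union>q\<in>Q. if card (diff_coords N w q) \<le> 2 then diff_coords N w q else {})"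
    have "card B \<le> (\<Sum>q\<in>Q. card (if card (diff_coords N w q) \<le> 2 then diff_coords N w q else {}))"
      unfolding B_def by (rule card_UN_le[OF Q(3)])
    also have "\<dots> \<le> (\<Sum>q\<in>Q. 2)" by (rule sum_mono) auto
    also have "\<dots> \<le> 2 * Suc M" using Q(4) P(3) by simp
    finally have cardB: "card B < d" by (simp add: d_def)
    have finB: "finite B" unfolding B_def using Q(3) by auto
    define T where "T = {l\<in>{l\<in>L. col l = i}. w \<in> S l \<and> S l \<subseteq> W}"
    \<comment> \<open>A line through \<open>w\<close> is recovered from its direction: the base
      function agrees with \<open>w\<close> elsewhere and is \<open>undefined\<close> there by
      extensionality. Hence the hyperedges at \<open>w\<close> have pairwise different directions,
      and one of them lies outside \<open>B\<close>.\<close>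
    have wl: "w = (snd l)(fst l := w (fst l)) \<and> snd l (fst l) = undefined" if "l \<in> T" for l
      using that by (auto simp: T_def S_def L_def PiE_iff extensional_def)
    have "inj_on fst T"
    proof (rule inj_onI)
      fix l l' assume l: "l \<in> T" "l' \<in> T" "fst l = fst l'"
      have "snd l = w(fst l := undefined)" "snd l' = w(fst l' := undefined)"
        using wl[OF l(1)] wl[OF l(2)] by (metis fun_upd_triv fun_upd_upd)+
      then show "l = l'" using l(3) by (simp add: prod_eq_iff)
    qed
    then have "card (fst ` T) = card T" by (rule card_image)
    then have "\<not> fst ` T \<subseteq> B" using deg[OF w(1)] cardB card_mono[OF finB, of "fst ` T"] by (auto simp: T_def)
    then obtain l where l: "l \<in> T" "fst l \<notin> B" by blast
    then have lL: "l \<in> L" "col l = i" "w \<in> S l" "S l \<subseteq> W" by (auto simp: T_def)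
    define j where "j = fst l"
    have j: "j < N" using lL(1) unfolding j_def L_def by (cases l) simp
    define e where "e v = \<phi> ((snd l)(j := g l v))" for v
    have eS: "e ` verts H = \<phi> ` S l" by (auto simp: e_def S_def j_def)
    have norm_e: "norm (e x - e y) = norm (g l x - g l y)" for x y
      using \<phi> j by (simp add: e_def generic_grid_map_def)
    have "unit_embedding ind H e"
    proof -
      have "e x = e y \<longleftrightarrow> g l x = g l y" for x y
        using norm_e[of x y] by (metis norm_eq_zero right_minus_eq)
      then show ?thesis using g[OF lL(1)] unfolding unit_embedding_def norm_e inj_on_def by simp
    qed
    moreover have "clear_of x (P - {y})" if x: "x \<in> e ` verts H - {y}" for x
      unfolding clear_of_def
    proof
      fix p assume "p \<in> P - {y}"
      then obtain q where q: "q \<in> Q" "p = \<phi> q" "q \<noteq> w" using Q w by auto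
      obtain x' where x': "x' \<in> S l" "x = \<phi> x'" "x' \<noteq> w" using x eS w by auto
      obtain v where v: "x' = (snd l)(j := g l v)" using x'(1) by (auto simp: S_def j_def)
      have wj: "w = (snd l)(j := w j)" using wl[OF l(1)] by (simp add: j_def)
      have xi: "x' m = w m" if "m \<noteq> j" for m using fun_cong[OF wj, of m] that by (simp add: v)
      have xj: "x' j \<noteq> w j"
      proof
        assume "x' j = w j"
        then have "x' m = w m" for m using xi by (cases "m = j") auto
        then show False using x'(3) by blast
      qed
      have "diff_coords N w q \<noteq> {}"
      proof
        assume "diff_coords N w q = {}"
        then have "w = q" using w(1) q(1) Q(1) W(1) by (intro grid_eqI) (auto simp: diff_coords_def)
        then show False using q by simp
      qed
      then have c0: "0 < card (diff_coords N w q)" by (simp add: card_gt_0_iff)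
      \<comment> \<open>Near \<open>w\<close> the step in the unblocked direction adds a new
        difference to at least one existing one; far from \<open>w\<close> a step removes at most
        one of at least three.\<close>
      have "2 \<le> card (diff_coords N x' q)"
      proof (cases "card (diff_coords N w q) \<le> 2")
        case True
        then have "diff_coords N w q \<subseteq> B" unfolding B_def using q(1) by auto
        then have jq: "j \<notin> diff_coords N w q" using l(2) by (auto simp: j_def)
        have "diff_coords N x' q = insert j (diff_coords N w q)"
          using jq xj xi j by (auto simp: diff_coords_def) metis+
        then show ?thesis using jq c0 by simp
      next
        case False
        have "diff_coords N w q - {j} \<subseteq> diff_coords N x' q" using xi by (auto simp: diff_coords_def)
        then have "card (diff_coords N w q - {j}) \<le> card (diff_coords N x' q)" by (intro card_mono) auto
        moreover have "card (diff_coords N w q) - 1 \<le> card (diff_coords N w q - {j})"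
          by (simp add: card_Diff_singleton_if)
        ultimately show ?thesis using False by linarith
      qed
      moreover have xq: "x' \<in> grid N X" "q \<in> grid N X" using x' q lL(4) W(1) Q(1) by auto
      ultimately have "x' \<noteq> q" "norm (\<phi> x' - \<phi> q) \<noteq> 1"
        using \<phi> unfolding generic_grid_map_def by (auto simp: diff_coords_def)
      then show "x \<noteq> p \<and> norm (x - p) \<noteq> 1"
        using x'(2) q(2) inj_onD[OF inj\<phi> _ xq] by blast
    qed
    ultimately show "\<exists>g. unit_embedding ind H g \<and> y \<in> g ` verts H \<and> g ` verts H \<subseteq> \<phi> ` W \<and>
             (\<forall>x\<in>g ` verts H - {y}. clear_of x (P - {y}))"
      using eS lL w by (intro exI[of _ e]) auto
  qed
  \<comment> \<open>Positive minimum degree puts every point of \<open>W\<close> on some copy of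
    colour \<open>i\<close>.\<close>
  moreover have "c (\<phi> w) = i" if w: "w \<in> W" for w
  proof -
    have "{l\<in>{l\<in>L. col l = i}. w \<in> S l \<and> S l \<subseteq> W} \<noteq> {}"
    proof
      assume "{l\<in>{l\<in>L. col l = i}. w \<in> S l \<and> S l \<subseteq> W} = {}"
      then show False using deg[OF w] by (simp only: card.empty d_def)
    qed
    then obtain l where "l \<in> L" "col l = i" "w \<in> S l" by blast
    then show ?thesis using g[of l] by (auto simp: S_def)
  qed
  then have "\<forall>y\<in>\<phi> ` W. c y = i" by blast
  ultimately show ?thesis by blast
qed

section \<open>Forests\<close>

lemma simple_graph_edge_subset: "simple_graph H \<Longrightarrow> e \<in> edges H \<Longrightarrow> e \<subseteq> verts H"
  unfolding simple_graph_def by blast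

lemma simple_graph_iso:
  assumes "graph_iso f H K" "simple_graph H"
  shows "simple_graph K"
proof -
  have f: "inj_on f (verts H)" "f ` verts H = verts K" "edges K = (\<lambda>e. f ` e) ` edges H"
    using assms by (auto simp: graph_iso_def bij_betw_def)
  have "\<exists>x y. e = {x, y} \<and> x \<in> verts K \<and> y \<in> verts K \<and> x \<noteq> y" if e: "e \<in> edges K" for e
  proof -
    obtain e' where e': "e' \<in> edges H" "e = f ` e'" using e f(3) by blast
    then obtain x y where xy: "e' = {x, y}" "x \<in> verts H" "y \<in> verts H" "x \<noteq> y"
      using assms(2) unfolding simple_graph_def by blast
    then have "f x \<noteq> f y" using f(1) by (auto simp: inj_on_def)
    moreover have "e = {f x, f y}" "f x \<in> verts K" "f y \<in> verts K" using e' xy f(2) by auto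
    ultimately show ?thesis by blast
  qed
  moreover have "finite (verts K)" "verts K \<noteq> {}"
    using assms(2) unfolding f(2)[symmetric] simple_graph_def by auto
  ultimately show ?thesis unfolding simple_graph_def by blast
qed

lemma graph_iso_edge_iff:
  assumes "graph_iso f H K" "simple_graph H" "x \<in> verts H" "y \<in> verts H"
  shows "{f x, f y} \<in> edges K \<longleftrightarrow> {x, y} \<in> edges H"
proof
  have f: "inj_on f (verts H)" "edges K = (\<lambda>e. f ` e) ` edges H"
    using assms by (auto simp: graph_iso_def bij_betw_def)
  show "{f x, f y} \<in> edges K" if "{x, y} \<in> edges H"
    using imageI[OF that, of "\<lambda>e. f ` e"] unfolding f(2) by simp
  assume "{f x, f y} \<in> edges K"
  then obtain e where e: "e \<in> edges H" "f ` e = f ` {x, y}" unfolding f(2) by auto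
  have "e = {x, y}"
    using inj_on_image_eq_iff[OF f(1) simple_graph_edge_subset[OF assms(2) e(1)], of "{x, y}"] e(2) assms by blast
  then show "{x, y} \<in> edges H" using e(1) by simp
qed

lemma graph_iso_inv:
  assumes "graph_iso f H K" "simple_graph H"
  shows "graph_iso (inv_into (verts H) f) K H"
proof -
  have f: "bij_betw f (verts H) (verts K)" "edges K = (\<lambda>e. f ` e) ` edges H"
    using assms by (auto simp: graph_iso_def)
  have "inv_into (verts H) f ` (f ` e) = e" if "e \<in> edges H" for e
    using f(1) simple_graph_edge_subset[OF assms(2) that]
    by (simp add: bij_betw_def inv_into_image_cancel)
  then have "(\<lambda>e. inv_into (verts H) f ` e) ` edges K = edges H"
    unfolding f(2) image_image by simp
  then show ?thesis using bij_betw_inv_into[OF f(1)] by (simp add: graph_iso_def)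
qed

lemma unit_embedding_iso:
  assumes "graph_iso f H K" "simple_graph H" "unit_embedding ind K g"
  shows "unit_embedding ind H (g \<circ> f)"
proof -
  have f: "inj_on f (verts H)" "f ` verts H = verts K"
    using assms by (auto simp: graph_iso_def bij_betw_def)
  have v: "f x \<in> verts K" if "x \<in> verts H" for x using f(2) that by blast
  have "inj_on (g \<circ> f) (verts H)" using f assms(3) by (intro comp_inj_on) (auto simp: unit_embedding_def)
  then show ?thesis
    using assms(3) v graph_iso_edge_iff[OF assms(1,2)] unfolding unit_embedding_def by simp
qed

lemma unit_embedding_cong:
  "(\<And>x. x \<in> verts H \<Longrightarrow> g x = g' x) \<Longrightarrow> unit_embedding ind H g \<longleftrightarrow> unit_embedding ind H g'"
  unfolding unit_embedding_def by (simp cong: inj_on_cong)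

text \<open>Attaches one more copy \<open>K\<close> to the embedded part \<open>U\<close>. The last
  conjunct keeps new vertices at non-unit distance from old ones outside \<open>K\<close>; it is
  what makes the embedding of the whole forest induced.\<close>

lemma forest_embedding_step:
  fixes H :: "'v graph" and K :: "'w graph" and \<theta> :: "'w \<Rightarrow> 'a::real_normed_vector"
  assumes H: "simple_graph H" "vertex_transitive H" and K: "copy_of K H"
    and W: "rich ind H M W" and U: "finite U" "card U \<le> M" "card (verts K \<inter> U) \<le> 1"
    and \<theta>: "inj_on \<theta> U" "\<theta> ` U \<subseteq> W"
  shows "\<exists>\<theta>'. inj_on \<theta>' (U \<union> verts K) \<and> \<theta>' ` (U \<union> verts K) \<subseteq> W \<and> (\<forall>x\<in>U. \<theta>' x = \<theta> x) \<and>
     unit_embedding ind K \<theta>' \<and> (\<forall>a\<in>verts K - U. \<forall>b\<in>U - verts K. norm (\<theta>' a - \<theta>' b) \<noteq> 1)"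
proof -
  define P where "P = \<theta> ` U"
  have P: "P \<subseteq> W" "finite P" "card P \<le> M" using \<theta> U by (auto simp: P_def card_image)
  obtain f where f: "graph_iso f H K" using K by (auto simp: copy_of_def)
  then have fK: "inj_on f (verts H)" "f ` verts H = verts K" by (auto simp: graph_iso_def bij_betw_def)
  \<comment> \<open>The vertex \<open>x\<close> of \<open>K\<close> is where the copy is hung: the
    common vertex with \<open>U\<close> if there is one, and otherwise any vertex, placed at a fresh
    point.\<close>
  obtain x w where x: "x \<in> verts K" "w \<in> W" "verts K \<inter> U \<subseteq> {x}" "x \<in> U \<Longrightarrow> w = \<theta> x"
    "x \<notin> U \<Longrightarrow> clear_of w P"
  proof (cases "verts K \<inter> U = {}")
    case True
    obtain w where "w \<in> W" "clear_of w P" using W P unfolding rich_def by blast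
    moreover obtain h where "h \<in> verts H" using H(1) by (auto simp: simple_graph_def)
    then have "f h \<in> verts K" using fK by blast
    ultimately show thesis using that[of "f h" w] True by blast
  next
    case False
    then obtain x where x: "x \<in> verts K" "x \<in> U" by blast
    have "verts K \<inter> U = {x}"
      using card_seteq[of "verts K \<inter> U" "{x}"] U x by auto
    then show thesis using that[of x "\<theta> x"] x \<theta> by auto
  qed
  obtain g where g: "unit_embedding ind H g" "w \<in> g ` verts H" "g ` verts H \<subseteq> W"
    and clear: "\<And>y. y \<in> g ` verts H \<Longrightarrow> y \<noteq> w \<Longrightarrow> clear_of y (P - {w})"
    using W P x(2) unfolding rich_def by (metis DiffI singletonD)
  obtain w' where w': "w' \<in> verts H" "g w' = w" using g(2) by blast
  obtain x' where x': "x' \<in> verts H" "f x' = x" using x(1) unfolding fK(2)[symmetric] by blast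
  \<comment> \<open>Richness does not say which vertex of \<open>H\<close> sits at \<open>w\<close>.
    The automorphism moves the one corresponding to \<open>x\<close> to the one that does.\<close>
  obtain \<sigma> where \<sigma>: "graph_iso \<sigma> H H" "\<sigma> x' = w'" using H(2) w' x' unfolding vertex_transitive_def by blast
  define e where "e = (g \<circ> \<sigma>) \<circ> inv_into (verts H) f"
  have e: "unit_embedding ind K e"
    unfolding e_def
    by (intro unit_embedding_iso[OF graph_iso_inv[OF f H(1)] simple_graph_iso[OF f H(1)]]
        unit_embedding_iso[OF \<sigma>(1) H(1)] g(1))
  then have inj_e: "inj_on e (verts K)" by (simp add: unit_embedding_def)
  have ex: "e x = w" using x' w' \<sigma>(2) fK(1) by (auto simp: e_def)
  have "inv_into (verts H) f v \<in> verts H" if "v \<in> verts K" for v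
    using that fK(2) by (metis inv_into_into)
  moreover have "\<sigma> v \<in> verts H" if "v \<in> verts H" for v
    using \<sigma>(1) that by (auto simp: graph_iso_def bij_betw_def)
  ultimately have eK: "e v \<in> g ` verts H" if "v \<in> verts K" for v using that by (simp add: e_def)
  have e_clear: "clear_of (e v) (P - {w})" if "v \<in> verts K" "v \<noteq> x" for v
  proof -
    have "e v \<noteq> w" using inj_onD[OF inj_e _ that(1) x(1)] that(2) ex by auto
    then show ?thesis using clear[OF eK[OF that(1)]] by blast
  qed
  define \<theta>' where "\<theta>' v = (if v \<in> U then \<theta> v else e v)" for v
  have \<theta>'K: "\<theta>' v = e v" if "v \<in> verts K" for v
    using that x(3,4) ex by (auto simp: \<theta>'_def)
  have new: "e a \<noteq> \<theta> b" if "a \<in> verts K - U" "b \<in> U" for a b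
  proof (cases "a = x")
    case True
    then show ?thesis using x(5) that ex by (auto simp: clear_of_def P_def)
  next
    case False
    have "e a \<noteq> w" using inj_onD[OF inj_e, of a x] False that x(1) ex by auto
    then show ?thesis using e_clear[of a] False that by (auto simp: clear_of_def P_def)
  qed
  have far: "norm (e a - \<theta> b) \<noteq> 1" if a: "a \<in> verts K - U" and b: "b \<in> U - verts K" for a b
  proof (cases "a = x")
    case True
    then show ?thesis using x(5) that ex by (auto simp: clear_of_def P_def)
  next
    case False
    \<comment> \<open>Richness clears new points only of \<open>P - {w}\<close>, so the image of
      \<open>b\<close> must be shown to differ from the exempted point.\<close>
    have "\<theta> b \<noteq> w"
    proof (cases "x \<in> U")
      case True
      then show ?thesis using x(1,4) b inj_onD[OF \<theta>(1), of b x] by auto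
    next
      case False
      then show ?thesis using x(5) b by (auto simp: clear_of_def P_def)
    qed
    then show ?thesis using e_clear[of a] False that by (auto simp: clear_of_def P_def)
  qed
  have "inj_on \<theta>' (U \<union> verts K)"
  proof (rule inj_onI)
    fix a b assume ab: "a \<in> U \<union> verts K" "b \<in> U \<union> verts K" "\<theta>' a = \<theta>' b"
    show "a = b"
    proof (cases "a \<in> U"; cases "b \<in> U")
      assume "a \<in> U" "b \<in> U" then show ?thesis using ab inj_onD[OF \<theta>(1)] by (simp add: \<theta>'_def)
    next
      assume "a \<in> U" "b \<notin> U" then show ?thesis using ab new[of b a] by (simp add: \<theta>'_def)
    next
      assume "a \<notin> U" "b \<in> U" then show ?thesis using ab new[of a b] by (simp add: \<theta>'_def)
    next
      assume "a \<notin> U" "b \<notin> U" then show ?thesis using ab inj_onD[OF inj_e] by (simp add: \<theta>'_def)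
    qed
  qed
  moreover have "\<theta>' ` (U \<union> verts K) \<subseteq> W" using \<theta>(2) eK g(3) by (auto simp: \<theta>'_def)
  moreover have "unit_embedding ind K \<theta>'" using e unit_embedding_cong[of K \<theta>' e] \<theta>'K by blast
  moreover have "\<forall>a\<in>verts K - U. \<forall>b\<in>U - verts K. norm (\<theta>' a - \<theta>' b) \<noteq> 1"
    using far by (simp add: \<theta>'_def)
  moreover have "\<forall>x\<in>U. \<theta>' x = \<theta> x" by (simp add: \<theta>'_def)
  ultimately show ?thesis by blast
qed

lemma is_forest_ofE:
  fixes F :: "'w graph"
  assumes "is_forest_of F H"
  obtains Hs :: "'w graph list" where "Hs \<noteq> []" "\<And>i. i < length Hs \<Longrightarrow> copy_of (Hs ! i) H"
    "\<And>i. i < length Hs \<Longrightarrow> card (verts (Hs ! i) \<inter> (\<Union>j<i. verts (Hs ! j))) \<le> 1"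
    "verts F = (\<Union>i<length Hs. verts (Hs ! i))" "edges F = (\<Union>i<length Hs. edges (Hs ! i))"
proof -
  obtain Hs :: "'w graph list" where Hs: "Hs \<noteq> []" "\<forall>i<length Hs. copy_of (Hs ! i) H"
    "\<forall>i<length Hs. card (verts (Hs ! i) \<inter> (\<Union>j<i. verts (Hs ! j))) \<le> 1"
    "F = (\<Union>i<length Hs. verts (Hs ! i), \<Union>i<length Hs. edges (Hs ! i))"
    using assms unfolding is_forest_of_def by blast
  show thesis by (rule that[of Hs]) (use Hs in simp_all)
qed

lemma forest_embedding:
  fixes H :: "'v graph" and F :: "'w graph" and W :: "'a::real_normed_vector set"
  assumes H: "simple_graph H" "vertex_transitive H" and F: "is_forest_of F H"
    and W: "rich ind H (card (verts F)) W"
  shows "\<exists>\<theta>. unit_embedding ind F \<theta> \<and> \<theta> ` verts F \<subseteq> W"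
proof -
  obtain Hs :: "'w graph list" where copy: "\<And>i. i < length Hs \<Longrightarrow> copy_of (Hs ! i) H"
    and meet: "\<And>i. i < length Hs \<Longrightarrow> card (verts (Hs ! i) \<inter> (\<Union>j<i. verts (Hs ! j))) \<le> 1"
    and vF: "verts F = (\<Union>i<length Hs. verts (Hs ! i))" and eF: "edges F = (\<Union>i<length Hs. edges (Hs ! i))"
    using is_forest_ofE[OF F] by metis
  have simp: "simple_graph (Hs ! i)" if "i < length Hs" for i
    using copy[OF that] simple_graph_iso H(1) unfolding copy_of_def by blast
  define U where "U i = (\<Union>j<i. verts (Hs ! j))" for i
  have finF: "finite (verts F)" unfolding vF using simp by (auto simp: simple_graph_def)
  have UF: "U i \<subseteq> verts F" if "i \<le> length Hs" for i using that by (fastforce simp: U_def vF)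
  \<comment> \<open>Pairs inside a common copy are governed by the embedding of that copy, all other
    pairs by the last clause of the invariant; together they decide every pair of vertices.\<close>
  have "\<exists>\<theta>. inj_on \<theta> (U i) \<and> \<theta> ` U i \<subseteq> W \<and> (\<forall>j<i. unit_embedding ind (Hs ! j) \<theta>) \<and>
     (\<forall>a\<in>U i. \<forall>b\<in>U i. (\<forall>j<i. \<not> (a \<in> verts (Hs ! j) \<and> b \<in> verts (Hs ! j))) \<longrightarrow> norm (\<theta> a - \<theta> b) \<noteq> 1)"
    if "i \<le> length Hs" for i
    using that
  proof (induction i)
    case 0
    then show ?case by (simp add: U_def)
  next
    case (Suc i)
    then obtain \<theta> where \<theta>: "inj_on \<theta> (U i)" "\<theta> ` U i \<subseteq> W"
      and emb: "\<And>j. j < i \<Longrightarrow> unit_embedding ind (Hs ! j) \<theta>"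
      and far: "\<And>a b. a \<in> U i \<Longrightarrow> b \<in> U i \<Longrightarrow>
        (\<forall>j<i. \<not> (a \<in> verts (Hs ! j) \<and> b \<in> verts (Hs ! j))) \<Longrightarrow> norm (\<theta> a - \<theta> b) \<noteq> 1"
      by auto
    have i: "i < length Hs" "U i \<subseteq> verts F" using Suc.prems UF by auto
    \<comment> \<open>The points to be avoided are images of forest vertices already placed, so
      \<open>card (verts F)\<close> is a sufficient bound at every stage.\<close>
    have "finite (U i)" "card (U i) \<le> card (verts F)"
      using i(2) finF by (auto intro: finite_subset card_mono)
    then obtain \<theta>' where \<theta>': "inj_on \<theta>' (U i \<union> verts (Hs ! i))" "\<theta>' ` (U i \<union> verts (Hs ! i)) \<subseteq> W"
      and ext: "\<And>x. x \<in> U i \<Longrightarrow> \<theta>' x = \<theta> x" and emb': "unit_embedding ind (Hs ! i) \<theta>'"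
      and far': "\<And>a b. a \<in> verts (Hs ! i) - U i \<Longrightarrow> b \<in> U i - verts (Hs ! i) \<Longrightarrow> norm (\<theta>' a - \<theta>' b) \<noteq> 1"
      using forest_embedding_step[OF H copy[OF i(1)] W _ _ meet[OF i(1), folded U_def] \<theta>] by blast
    have US: "U (Suc i) = U i \<union> verts (Hs ! i)" by (auto simp: U_def less_Suc_eq)
    have "unit_embedding ind (Hs ! j) \<theta>'" if "j < Suc i" for j
    proof (cases "j = i")
      case False
      then have "j < i" using that by simp
      then have "\<theta>' x = \<theta> x" if "x \<in> verts (Hs ! j)" for x using that by (intro ext) (auto simp: U_def)
      then show ?thesis using emb[OF \<open>j < i\<close>] unit_embedding_cong[of "Hs ! j" \<theta>' \<theta>] by blast
    qed (simp add: emb')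
    moreover have "norm (\<theta>' a - \<theta>' b) \<noteq> 1" if a: "a \<in> U (Suc i)" and b: "b \<in> U (Suc i)"
      and no: "\<forall>j<Suc i. \<not> (a \<in> verts (Hs ! j) \<and> b \<in> verts (Hs ! j))" for a b
    proof -
      have "\<not> (a \<in> verts (Hs ! i) \<and> b \<in> verts (Hs ! i))" using no by blast
      then consider "a \<in> U i" "b \<in> U i" | "a \<in> verts (Hs ! i) - U i" "b \<in> U i - verts (Hs ! i)"
        | "b \<in> verts (Hs ! i) - U i" "a \<in> U i - verts (Hs ! i)"
        using a b unfolding US by blast
      then show ?thesis
      proof cases
        case 1
        then show ?thesis using far[of a b] no ext by simp
      next
        case 2
        then show ?thesis by (rule far')
      next
        case 3
        then show ?thesis using far'[of b a] by (simp add: norm_minus_commute)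
      qed
    qed
    ultimately show ?case using \<theta>' unfolding US by blast
  qed
  from this[OF order_refl] obtain \<theta> where inj: "inj_on \<theta> (verts F)" and "\<theta> ` verts F \<subseteq> W"
    and emb: "\<And>j. j < length Hs \<Longrightarrow> unit_embedding ind (Hs ! j) \<theta>"
    and far: "\<And>a b. a \<in> verts F \<Longrightarrow> b \<in> verts F \<Longrightarrow>
       (\<forall>j<length Hs. \<not> (a \<in> verts (Hs ! j) \<and> b \<in> verts (Hs ! j))) \<Longrightarrow> norm (\<theta> a - \<theta> b) \<noteq> 1"
    unfolding U_def vF[symmetric] by auto
  have "norm (\<theta> x - \<theta> y) = 1" if "{x, y} \<in> edges F" for x y
  proof -
    obtain j where j: "j < length Hs" "{x, y} \<in> edges (Hs ! j)" using \<open>{x, y} \<in> edges F\<close> eF by auto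
    then have "x \<in> verts (Hs ! j)" "y \<in> verts (Hs ! j)"
      using simple_graph_edge_subset[OF simp[OF j(1)] j(2)] by auto
    then show ?thesis using emb[OF j(1)] j(2) by (simp add: unit_embedding_def)
  qed
  moreover have "norm (\<theta> x - \<theta> y) \<noteq> 1"
    if ind and xy: "x \<in> verts F" "y \<in> verts F" "{x, y} \<notin> edges F" for x y
  proof (cases "\<exists>j<length Hs. x \<in> verts (Hs ! j) \<and> y \<in> verts (Hs ! j)")
    case True
    then obtain j where j: "j < length Hs" "x \<in> verts (Hs ! j)" "y \<in> verts (Hs ! j)" by blast
    then have "{x, y} \<notin> edges (Hs ! j)" using xy eF by auto
    then show ?thesis using emb[OF j(1)] j \<open>ind\<close> by (simp add: unit_embedding_def)
  next
    case False
    then show ?thesis using far xy by blast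
  qed
  ultimately have "unit_embedding ind F \<theta>" using inj by (simp add: unit_embedding_def)
  then show ?thesis using \<open>\<theta> ` verts F \<subseteq> W\<close> by blast
qed

text \<open>The first copy is an induced subgraph of the forest: an edge of a later copy between two
  of its vertices would give that copy two vertices in common with the earlier ones. So an induced
  embedding of the forest restricts to one of \<open>H\<close>.\<close>

lemma avoids_forest:
  fixes H :: "'v graph" and F :: "'w graph"
  assumes H: "simple_graph H" and F: "is_forest_of F H" and c: "avoids ind H c"
  shows "avoids ind F c"
  unfolding avoids_def
proof clarify
  obtain Hs :: "'w graph list" where "Hs \<noteq> []" and copy: "\<And>i. i < length Hs \<Longrightarrow> copy_of (Hs ! i) H"
    and meet: "\<And>i. i < length Hs \<Longrightarrow> card (verts (Hs ! i) \<inter> (\<Union>j<i. verts (Hs ! j))) \<le> 1"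
    and vF: "verts F = (\<Union>i<length Hs. verts (Hs ! i))" and eF: "edges F = (\<Union>i<length Hs. edges (Hs ! i))"
    using is_forest_ofE[OF F] by metis
  then have l: "0 < length Hs" by simp
  have simp: "simple_graph (Hs ! i)" if "i < length Hs" for i
    using copy[OF that] simple_graph_iso H(1) unfolding copy_of_def by blast
  have v0: "verts (Hs ! 0) \<subseteq> verts F" and e0: "edges (Hs ! 0) \<subseteq> edges F" using l vF eF by auto
  have ind0: "{x, y} \<in> edges (Hs ! 0)"
    if xy: "x \<in> verts (Hs ! 0)" "y \<in> verts (Hs ! 0)" "{x, y} \<in> edges F" for x y
  proof -
    obtain i where i: "i < length Hs" "{x, y} \<in> edges (Hs ! i)" using xy(3) eF by auto
    have "i = 0"
    proof (rule ccontr)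
      assume "i \<noteq> 0"
      obtain p q where "{x, y} = {p, q}" "p \<noteq> q" using simp[OF i(1)] i(2) unfolding simple_graph_def by blast
      then have "x \<noteq> y" by (auto simp: doubleton_eq_iff)
      have sub: "{x, y} \<subseteq> verts (Hs ! i) \<inter> (\<Union>j<i. verts (Hs ! j))"
        using simple_graph_edge_subset[OF simp[OF i(1)] i(2)] xy \<open>i \<noteq> 0\<close> by auto
      have "finite (verts (Hs ! i) \<inter> (\<Union>j<i. verts (Hs ! j)))"
        using simp[OF i(1)] by (simp add: simple_graph_def)
      then have "card {x, y} \<le> 1" using card_mono[OF _ sub] meet[OF i(1)] by linarith
      then show False using \<open>x \<noteq> y\<close> by simp
    qed
    then show ?thesis using i by simp
  qed
  obtain f where f: "graph_iso f H (Hs ! 0)" using copy[OF l] by (auto simp: copy_of_def)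
  fix g assume g: "unit_embedding ind F g" "monochromatic c (g ` verts F)"
  have inj: "inj_on g (verts (Hs ! 0))"
    using g(1) v0 unfolding unit_embedding_def by (meson inj_on_subset)
  have "unit_embedding ind (Hs ! 0) g"
    unfolding unit_embedding_def
  proof (intro conjI ballI impI)
    show "norm (g x - g y) = 1" if "x \<in> verts (Hs ! 0)" "y \<in> verts (Hs ! 0)" "{x, y} \<in> edges (Hs ! 0)" for x y
      using g(1) that v0 e0 unfolding unit_embedding_def by blast
    show "norm (g x - g y) \<noteq> 1"
      if "ind" "x \<in> verts (Hs ! 0)" "y \<in> verts (Hs ! 0)" "{x, y} \<notin> edges (Hs ! 0)" for x y
      using g(1) that v0 ind0 unfolding unit_embedding_def by blast
  qed (rule inj)
  then have "unit_embedding ind H (g \<circ> f)" by (rule unit_embedding_iso[OF f H])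
  moreover have "(g \<circ> f) ` verts H \<subseteq> g ` verts F"
    using f v0 by (auto simp: graph_iso_def bij_betw_def)
  then have "monochromatic c ((g \<circ> f) ` verts H)" using g(2) unfolding monochromatic_def by blast
  ultimately show False using c unfolding avoids_def by blast
qed

lemma forest_avoidable_iff:
  fixes H :: "'v graph" and F :: "'w graph"
  assumes dim: "2 \<le> DIM('a::euclidean_space)" and H: "simple_graph H" "vertex_transitive H"
    and F: "is_forest_of F H"
  shows "(\<exists>c :: 'a \<Rightarrow> nat. c \<in> UNIV \<rightarrow> {..<r} \<and> avoids ind F c) \<longleftrightarrow>
    (\<exists>c :: 'a \<Rightarrow> nat. c \<in> UNIV \<rightarrow> {..<r} \<and> avoids ind H c)"
proof
  assume "\<exists>c :: 'a \<Rightarrow> nat. c \<in> UNIV \<rightarrow> {..<r} \<and> avoids ind H c"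
  then show "\<exists>c :: 'a \<Rightarrow> nat. c \<in> UNIV \<rightarrow> {..<r} \<and> avoids ind F c"
    using avoids_forest[OF H(1) F] by blast
next
  assume "\<exists>c :: 'a \<Rightarrow> nat. c \<in> UNIV \<rightarrow> {..<r} \<and> avoids ind F c"
  then obtain c :: "'a \<Rightarrow> nat" where c: "c \<in> UNIV \<rightarrow> {..<r}" "avoids ind F c" by blast
  show "\<exists>c :: 'a \<Rightarrow> nat. c \<in> UNIV \<rightarrow> {..<r} \<and> avoids ind H c"
  proof (rule ccontr)
    assume "\<not> ?thesis"
    then have bad: "\<not> avoids ind H c'" if "c' \<in> UNIV \<rightarrow> {..<r}" for c' :: "'a \<Rightarrow> nat" using that by blast
    obtain i W where W: "\<forall>x\<in>W. c x = i" "rich ind H (card (verts F)) W"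
      using exists_rich_set[OF dim c(1) H(1) bad, of "card (verts F)"] by blast
    obtain \<theta> where \<theta>: "unit_embedding ind F \<theta>" "\<theta> ` verts F \<subseteq> W" using forest_embedding[OF H F W(2)] by blast
    have "monochromatic c (\<theta> ` verts F)" using \<theta>(2) W(1) unfolding monochromatic_def by blast
    then show False using c(2) \<theta>(1) unfolding avoids_def by blast
  qed
qed

theorem theorem1p5:
  fixes H :: "'v graph"
  assumes "simple_graph H" and "CARD('n::finite) \<ge> 2"
  shows
    "(\<forall>F :: 'w graph. vertex_transitive H \<longrightarrow> is_forest_of F H \<longrightarrow>
        chi_copy F (UNIV :: (real^'n) set) = chi_copy H (UNIV :: (real^'n) set) \<and>
        chi_ind_copy F (UNIV :: (real^'n) set) = chi_ind_copy H (UNIV :: (real^'n) set)) \<and>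
     (edges H \<noteq> {} \<longrightarrow>
        (zero_cube_density H \<longrightarrow>
           chi_copy H (UNIV :: (real^'n) set) = chi (UNIV :: (real^'n) set)) \<and>
        (zero_induced_cube_density H \<longrightarrow>
           chi_ind_copy H (UNIV :: (real^'n) set) = chi (UNIV :: (real^'n) set))) \<and>
     (\<forall>u v (\<Gamma> :: 'g graph) A B.
        u \<in> verts H \<longrightarrow> v \<in> verts H \<longrightarrow> u \<noteq> v \<longrightarrow>
        simple_graph \<Gamma> \<longrightarrow> edges \<Gamma> \<noteq> {} \<longrightarrow> bipartite_with_parts \<Gamma> A B \<longrightarrow>
        zero_strong_cube_density \<Gamma> A B \<longrightarrow>
        chi_copy (edge_replacement \<Gamma> A B H u v) (UNIV :: (real^'n) set) =
          chi_copy H (UNIV :: (real^'n) set))"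
proof -
  have dim: "2 \<le> DIM(real^'n)" using assms(2) by simp
  note H = assms(1)
  \<comment> \<open>The equivalence for forests holds for either value of the flag, so one rewriting
    of the index sets settles both numbers.\<close>
  have "chi_copy F (UNIV :: (real^'n) set) = chi_copy H (UNIV :: (real^'n) set)"
    "chi_ind_copy F (UNIV :: (real^'n) set) = chi_ind_copy H (UNIV :: (real^'n) set)"
    if "vertex_transitive H" "is_forest_of F H" for F :: "'w graph"
    unfolding chi_copy_UNIV chi_ind_copy_UNIV forest_avoidable_iff[OF dim H that] by (rule refl)+
  moreover have "chi_copy H (UNIV :: (real^'n) set) = chi (UNIV :: (real^'n) set)"
    if E: "edges H \<noteq> {}" and D: "zero_cube_density H"
  proof -
    have "(\<lambda>N. real (Max {card (edges G) | G. subgraph G (hypercube N) \<and> \<not> cube_contains False G H}) /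
      real (card (edges (hypercube N)))) \<longlonglongrightarrow> 0"
      using D by (simp add: zero_cube_density_def cube_ex_def cube_contains_def)
    from zero_density_avoidable_iff[OF dim H E this] show ?thesis
      unfolding chi_copy_UNIV chi_def by simp
  qed
  moreover have "chi_ind_copy H (UNIV :: (real^'n) set) = chi (UNIV :: (real^'n) set)"
    if E: "edges H \<noteq> {}" and D: "zero_induced_cube_density H"
  proof -
    have "(\<lambda>N. real (Max {card (edges G) | G. subgraph G (hypercube N) \<and> \<not> cube_contains True G H}) /
      real (card (edges (hypercube N)))) \<longlonglongrightarrow> 0"
      using D by (simp add: zero_induced_cube_density_def cube_ex_ind_def cube_contains_def)
    from zero_density_avoidable_iff[OF dim H E this] show ?thesis
      unfolding chi_ind_copy_UNIV chi_def by simp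
  qed
  moreover have "chi_copy (edge_replacement \<Gamma> A B H u v) (UNIV :: (real^'n) set) =
      chi_copy H (UNIV :: (real^'n) set)"
    if "u \<in> verts H" "v \<in> verts H" "u \<noteq> v" "edges \<Gamma> \<noteq> {}" "bipartite_with_parts \<Gamma> A B"
      "zero_strong_cube_density \<Gamma> A B" for u v and \<Gamma> :: "'g graph" and A B
    unfolding chi_copy_UNIV edge_replacement_avoidable_iff[OF dim H that] by (rule refl)
  ultimately show ?thesis by blast
qed

end
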